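(* Let $d \ge 1$, let $X, X_1, X_2, \ldots$ be i.i.d. random vectors in $\mathbb{R}^d$, and let $S_n = \sum_{i=1}^n X_i$ and $G_n = \frac1n \sum_{i=1}^n S_i$ for $n \ge 1$. Suppose that $\mathbb{E}[\|X\|^2] < \infty$ and that, with $\mu := \mathbb{E} X$, the matrix $M := \mathbb{E}[(X-\mu)(X-\mu)^\top]$ is positive-definite. Suppose that $H$ is a real $d \times d$ matrix with $h := |\det H| > 0$ such that $H\mathbb{Z}^d$ is the minimal subgroup associated with $X$, and let $b \in \mathbb{R}^d$ be such that $\mathbb{P}(X \in b + H\mathbb{Z}^d) = 1$. For $n \ge 1$ and $x \in \mathbb{R}^d$ define $$\mathcal{L}_n := \left\{ n^{-3/2}\left( \tfrac12 n(n+1) b + H z \right) : z \in \mathbb{Z}^d \right\}, \qquad p_n(x) := \mathbb{P}(n^{-1/2} G_n = x), \qquad \nu(x) := \frac{\exp\{-\tfrac32 x^\top M^{-1} x\}}{(2\pi)^{d/2} \sqrt{\det(M/3)}}.$$ Then $$\lim_{n \to \infty} \sup_{x \in \mathcal{L}_n} \left| \frac{n^{3d/2}}{h} p_n(x) - \nu\left( x - \frac{(n+1)}{2 n^{1/2}} \mu \right) \right| = 0.$$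
   Context: Vectors are column vectors and $\|\cdot\|$ is the Euclidean norm. "$H\mathbb{Z}^d$ is the minimal subgroup associated with $X$" means: $\mathbb{P}(X \in b + H\mathbb{Z}^d) = 1$ for some $b \in \mathbb{R}^d$, and whenever $\mathbb{P}(X \in x + L') = 1$ for some $x \in \mathbb{R}^d$ and some closed subgroup $L'$ of $\mathbb{R}^d$, one has $H\mathbb{Z}^d \subseteq L'$. *)

theory Defs
  imports "HOL-Probability.Probability"
begin

definition int_points :: "(real ^ 'd) set" where
  "int_points = {z. \<forall>i. z $ i \<in> \<int>}"

definition lattice_of :: "real ^ 'd ^ 'd \<Rightarrow> (real ^ 'd) set" where
  "lattice_of H = (\<lambda>z. H *v z) ` int_points"

definition closed_subgroup :: "(real ^ 'd) set \<Rightarrow> bool" where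
  "closed_subgroup L \<longleftrightarrow>
     closed L \<and> 0 \<in> L \<and> (\<forall>x\<in>L. \<forall>y\<in>L. x + y \<in> L) \<and> (\<forall>x\<in>L. - x \<in> L)"

definition coset_prob :: "'w measure \<Rightarrow> ('w \<Rightarrow> real ^ 'd) \<Rightarrow> real ^ 'd \<Rightarrow> (real ^ 'd) set \<Rightarrow> real" where
  "coset_prob P Y b L = measure P {w \<in> space P. Y w \<in> (+) b ` L}"

definition minimal_subgroup :: "'w measure \<Rightarrow> ('w \<Rightarrow> real ^ 'd) \<Rightarrow> real ^ 'd ^ 'd \<Rightarrow> bool" where
  "minimal_subgroup P Y H \<longleftrightarrow>
     (\<exists>b. coset_prob P Y b (lattice_of H) = 1) \<and>
     (\<forall>x L. closed_subgroup L \<and> coset_prob P Y x L = 1 \<longrightarrow> lattice_of H \<subseteq> L)"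

definition cov_matrix :: "'w measure \<Rightarrow> ('w \<Rightarrow> real ^ 'd) \<Rightarrow> real ^ 'd ^ 'd" where
  "cov_matrix P Y =
     (let \<mu> = integral\<^sup>L P Y
      in integral\<^sup>L P (\<lambda>w. (columnvector (Y w - \<mu>) :: real ^ 1 ^ 'd) ** rowvector (Y w - \<mu>)))"

definition positive_definite :: "real ^ 'd ^ 'd \<Rightarrow> bool" where
  "positive_definite A \<longleftrightarrow> transpose A = A \<and> (\<forall>x. x \<noteq> 0 \<longrightarrow> x \<bullet> (A *v x) > 0)"

text \<open>The increments are \<open>X 1, X 2, \<dots>\<close>; \<open>X 0\<close> does not enter the sums and is
  free to serve as the generic copy of the increments.\<close>

definition walk :: "(nat \<Rightarrow> 'w \<Rightarrow> real ^ 'd) \<Rightarrow> nat \<Rightarrow> 'w \<Rightarrow> real ^ 'd" where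
  "walk X n w = (\<Sum>i=1..n. X i w)"

definition centre_of_mass :: "(nat \<Rightarrow> 'w \<Rightarrow> real ^ 'd) \<Rightarrow> nat \<Rightarrow> 'w \<Rightarrow> real ^ 'd" where
  "centre_of_mass X n w = (1 / real n) *\<^sub>R (\<Sum>i=1..n. walk X i w)"

definition scaled_lattice :: "real ^ 'd ^ 'd \<Rightarrow> real ^ 'd \<Rightarrow> nat \<Rightarrow> (real ^ 'd) set" where
  "scaled_lattice H b n =
     (\<lambda>z. (real n powr (- 3 / 2)) *\<^sub>R ((1 / 2 * real n * (real n + 1)) *\<^sub>R b + H *v z)) ` int_points"

definition com_pmf :: "'w measure \<Rightarrow> (nat \<Rightarrow> 'w \<Rightarrow> real ^ 'd) \<Rightarrow> nat \<Rightarrow> real ^ 'd \<Rightarrow> real" where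
  "com_pmf P X n x =
     measure P {w \<in> space P. (real n powr (- 1 / 2)) *\<^sub>R centre_of_mass X n w = x}"

definition gauss_density :: "real ^ 'd ^ 'd \<Rightarrow> real ^ 'd \<Rightarrow> real" where
  "gauss_density M x =
     exp (- 3 / 2 * (x \<bullet> (matrix_inv M *v x))) /
     ((2 * pi) powr (real CARD('d) / 2) * sqrt (det ((1 / 3) *\<^sub>R M)))"

end

theory Submission
  imports Defs "HOL-Real_Asymp.Real_Asymp"
begin

text \<open>
  The theorem is a local central limit theorem, proved by Fourier inversion. Writing
  \<open>X j = b + H Z j\<close> turns the increments into integer vectors, and exchanging the order of
  summation turns the centre of mass into a weighted sum: \<open>n^{-1/2} G_n = x\<close> holds exactly when
  \<open>W n = (\<Sum>j=1..n. (n + 1 - j) Z j)\<close> equals the integer vector \<open>z\<close> labelling \<open>x\<close>. Inversion on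
  the cube \<open>[-\<pi>, \<pi>]^d\<close>, followed by the substitution \<open>t = n^{-3/2} u\<close>, writes \<open>n^{3d/2} P(W n = z)\<close> as
  an integral of \<open>cis (-(u \<bullet> y)) * J n u\<close>, where \<open>y\<close> is the rescaled centred lattice point and
  \<open>J n u\<close> is the product over \<open>j \<le> n\<close> of the values \<open>\<psi> (j n^{-3/2} u)\<close> of the characteristic
  function of the centred step, cut off to the rescaled cube. As \<open>z\<close> enters only through a factor
  of modulus 1, uniformity in \<open>z\<close> is automatic once \<open>J n\<close> converges in \<open>L^1\<close> to the Gaussian
  \<open>exp (-Q u / 6)\<close>, with \<open>Q\<close> the covariance form of the step; the factor 6 arises from
  \<open>(\<Sum>j\<le>n. j^2) / n^3 \<longlonglongrightarrow> 1/3\<close> (\<open>tendsto_weighted_prod_gaussian\<close>).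

  To control the integrand, let \<open>V\<close> be the difference of two independent steps, so that
  \<open>|\<psi> t|^2 = 1 - gap t\<close> with \<open>gap t = E (1 - cos (t \<bullet> V))\<close>, and hence
  \<open>|J n u| \<le> exp (- (\<Sum>j\<le>n. gap (j t)) / 2)\<close> for \<open>t = n^{-3/2} u\<close>. Two regimes cover the whole cube.
  For \<open>|u| \<le> \<delta> n^{1/2}\<close> all arguments are small, where the gap is bounded below by a quadratic
  form (\<open>gap_quadratic_lower_bound\<close>); this gives a Gaussian majorant and dominated convergence
  applies. For larger \<open>u\<close> the multiples \<open>j t\<close> may wrap around the torus and return to lattice
  points, where \<open>|\<psi>| = 1\<close>. But they cannot do so too often: if \<open>k t\<close> is away from the lattice, then
  \<open>gap (k t) \<le> 2 gap ((j + k) t) + 2 gap (j t)\<close> forbids \<open>j t\<close> and \<open>(j + k) t\<close> from both being bad, and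
  in this regime some \<open>k \<le> n/2\<close> of this kind exists. So the sum of the gaps is at least \<open>\<eta> n\<close>
  (\<open>sum_gap_lower_bound\<close>), and this part of the integral is exponentially small.

  Minimality of the subgroup enters through aperiodicity: \<open>|\<psi> t| = 1\<close> at a nonzero \<open>t\<close> of the cube
  would place the step in a coset of a closed subgroup that does not contain the lattice
  (\<open>minimal_subgroup_aperiodic\<close>). Finally the Fourier transform of the Gaussian is evaluated by a
  linear substitution with a matrix that turns \<open>Q\<close> into the squared norm
  (\<open>positive_definite_imp_whitening\<close>, \<open>gaussian_fourier\<close>).
\<close>

section \<open>Elementary facts\<close>

lemma norm_diff_square_le:
  fixes a b :: "'a :: real_inner"
  shows "(norm (a - b))\<^sup>2 \<le> 2 * (norm a)\<^sup>2 + 2 * (norm b)\<^sup>2"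
  using inner_ge_zero[of "a + b"] by (simp add: power2_norm_eq_inner inner_simps inner_commute)

lemma inner_square_le:
  fixes a b :: "'a :: real_inner"
  shows "(a \<bullet> b)\<^sup>2 \<le> (norm a)\<^sup>2 * (norm b)\<^sup>2"
  using Cauchy_Schwarz_ineq2[of a b] by (simp add: power_mult_distrib[symmetric] power2_le_iff_abs_le)

lemma norm_square_vec: "(norm (u :: real ^ 'd))\<^sup>2 = (\<Sum>i\<in>UNIV. (u $ i)\<^sup>2)"
  unfolding power2_norm_eq_inner inner_vec_def by (simp add: power2_eq_square)

lemma sum_squares_nat: "(\<Sum>j=1..n. (real j)\<^sup>2) = real n * (real n + 1) * (2 * real n + 1) / 6"
  by (induction n) (auto simp: field_simps power2_eq_square)

lemma sum_weights_scaleR: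
  fixes v :: "'a :: real_vector"
  shows "(\<Sum>j=1..n. (real n + 1 - real j) *\<^sub>R v) = (real n * (real n + 1) / 2) *\<^sub>R v"
proof -
  have "(\<Sum>j=1..n. (real n + 1 - real j)) = real n * (real n + 1) / 2"
    by (induction n) (auto simp: field_simps sum.distrib sum_subtractf)
  then show ?thesis by (simp only: scaleR_sum_left[symmetric])
qed

lemma powr_three_halves_square:
  assumes "n > 0"
  shows "(real n powr (- 3 / 2))\<^sup>2 = 1 / real n ^ 3"
proof -
  have "(real n powr (- 3 / 2))\<^sup>2 = real n powr (- 3)"
    unfolding power2_eq_square powr_add[symmetric] by simp
  also have "\<dots> = 1 / real n powr (real 3)"
    unfolding powr_minus_divide by simp
  also have "\<dots> = 1 / real n ^ 3"
    using assms by (subst powr_realpow) auto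
  finally show ?thesis .
qed

lemma (in prob_space) integrable_of_square_norm:
  fixes V :: "'a \<Rightarrow> 'b :: euclidean_space"
  assumes [measurable]: "V \<in> borel_measurable M" and "integrable M (\<lambda>w. (norm (V w))\<^sup>2)"
  shows "integrable M V"
proof -
  have "integrable M (\<lambda>w. norm (V w))"
    by (rule square_integrable_imp_integrable) (auto simp: assms(2))
  then show ?thesis by (subst (asm) integrable_norm_iff) auto
qed

section \<open>Linear substitutions in Lebesgue integrals\<close>

lemma borel_measurable_vec_lambda [measurable (raw)]:
  assumes "\<And>i. (\<lambda>x. f x i) \<in> borel_measurable M"
  shows "(\<lambda>x. (\<chi> i. f x i) :: real ^ 'd) \<in> borel_measurable M"
  using assms by (subst borel_measurable_euclidean_space) (auto simp: Basis_vec_def inner_axis)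

lemma borel_measurable_matrix_vector_mult [measurable (raw)]:
  fixes A :: "real ^ 'd ^ 'e"
  assumes "f \<in> borel_measurable M"
  shows "(\<lambda>x. A *v f x) \<in> borel_measurable M"
  by (rule measurable_compose[OF assms borel_measurable_continuous_onI])
     (rule matrix_vector_mult_linear_continuous_on)

lemma prod_Basis_vec:
  fixes f :: "real ^ 'd \<Rightarrow> 'b :: comm_monoid_mult"
  shows "(\<Prod>b\<in>Basis. f b) = (\<Prod>i\<in>UNIV. f (axis i 1))"
  by (rule prod.reindex_bij_witness[of _ "\<lambda>i. axis i 1" "\<lambda>b. axis_index b"])
     (auto simp: Basis_vec_def axis_index_axis)

text \<open>
  Coordinates indexed by the type \<open>'d\<close> itself, instead of the vectors of \<open>Basis\<close>, make Fubini
  arguments in a single coordinate direct.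
\<close>
lemma lborel_vec_eq_PiM:
  "(lborel :: (real ^ 'd) measure) = distr (Pi\<^sub>M UNIV (\<lambda>_. lborel)) borel (\<lambda>f. \<chi> i. f i)"
proof (rule lborel_eqI)
  interpret product_sigma_finite "\<lambda>_::'d. lborel :: real measure" by standard
  interpret finite_product_sigma_finite "\<lambda>_::'d. lborel :: real measure" UNIV by standard auto
  have meas [measurable]: "(\<lambda>f. \<chi> i. f i) \<in> Pi\<^sub>M UNIV (\<lambda>_::'d. lborel :: real measure) \<rightarrow>\<^sub>M borel"
    by (rule borel_measurable_vec_lambda) simp
  fix l u :: "real ^ 'd"
  assume le: "\<And>b. b \<in> Basis \<Longrightarrow> l \<bullet> b \<le> u \<bullet> b"
  have le': "l $ i \<le> u $ i" for i
    using le[of "axis i 1"] by (auto simp: inner_axis Basis_vec_def)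
  have "emeasure (distr (Pi\<^sub>M UNIV (\<lambda>_. lborel)) borel (\<lambda>f. \<chi> i. f i)) (box l u)
      = emeasure (Pi\<^sub>M UNIV (\<lambda>_. lborel)) (Pi\<^sub>E UNIV (\<lambda>i. {l $ i <..< u $ i}))"
    by (subst emeasure_distr) (auto intro!: arg_cong2[where f = emeasure] simp: mem_box_cart space_PiM PiE_iff)
  also have "\<dots> = (\<Prod>i\<in>UNIV. ennreal (u $ i - l $ i))"
    by (subst emeasure_PiM) (auto simp: le')
  also have "\<dots> = ennreal (\<Prod>i\<in>UNIV. (u - l) $ i)"
    by (subst prod_ennreal) (auto simp: le')
  also have "(\<Prod>i\<in>UNIV. (u - l) $ i) = (\<Prod>b\<in>Basis. (u - l) \<bullet> b)"
    by (simp add: prod_Basis_vec inner_axis)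
  finally show "emeasure (distr (Pi\<^sub>M UNIV (\<lambda>_. lborel)) borel (\<lambda>f. \<chi> i. f i)) (box l u)
      = ennreal (\<Prod>b\<in>Basis. (u - l) \<bullet> b)" .
qed simp

lemma
  fixes f :: "'d::finite \<Rightarrow> real \<Rightarrow> complex"
  assumes "\<And>i. integrable lborel (f i)"
  shows integrable_lborel_vec_prod: "integrable lborel (\<lambda>u :: real ^ 'd. \<Prod>i\<in>UNIV. f i (u $ i))"
    and integral_lborel_vec_prod:
      "(\<integral>u. (\<Prod>i\<in>UNIV. f i (u $ i)) \<partial>(lborel :: (real ^ 'd) measure)) = (\<Prod>i\<in>UNIV. \<integral>x. f i x \<partial>lborel)"
proof -
  interpret product_sigma_finite "\<lambda>_::'d. lborel :: real measure" by standard
  have [measurable]: "f i \<in> borel_measurable borel" for i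
    using borel_measurable_integrable[OF assms[of i]] by simp
  have meas [measurable]: "(\<lambda>f. \<chi> i. f i) \<in> Pi\<^sub>M UNIV (\<lambda>_::'d. lborel :: real measure) \<rightarrow>\<^sub>M borel"
    by (rule borel_measurable_vec_lambda) simp
  have [measurable]: "(\<lambda>u :: real ^ 'd. \<Prod>i\<in>UNIV. f i (u $ i)) \<in> borel_measurable borel"
    by measurable
  show "integrable lborel (\<lambda>u :: real ^ 'd. \<Prod>i\<in>UNIV. f i (u $ i))"
    by (subst lborel_vec_eq_PiM, subst integrable_distr_eq)
       (auto intro!: product_integrable_prod assms)
  show "(\<integral>u. (\<Prod>i\<in>UNIV. f i (u $ i)) \<partial>(lborel :: (real ^ 'd) measure)) = (\<Prod>i\<in>UNIV. \<integral>x. f i x \<partial>lborel)"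
    by (subst lborel_vec_eq_PiM, subst integral_distr)
       (auto intro!: product_integral_prod assms)
qed

text \<open>
  The shear adds to coordinate \<open>m\<close> an amount that depends only on another coordinate. Integrating
  over coordinate \<open>m\<close> first, this is a translation of the inner integral.
\<close>
lemma nn_integral_lborel_vec_shear:
  fixes f :: "real ^ 'd \<Rightarrow> ennreal"
  assumes [measurable]: "f \<in> borel_measurable borel" and "m \<noteq> k"
  shows "(\<integral>\<^sup>+x. f (x + (c * x $ k) *\<^sub>R axis m 1) \<partial>lborel) = (\<integral>\<^sup>+x. f x \<partial>lborel)"
proof -
  let ?L = "\<lambda>_::'d. lborel :: real measure"
  interpret product_sigma_finite ?L by standard
  have meas [measurable]: "(\<lambda>f. \<chi> i. f i) \<in> Pi\<^sub>M UNIV ?L \<rightarrow>\<^sub>M borel"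
    by (rule borel_measurable_vec_lambda) simp
  have un: "UNIV = insert m (UNIV - {m})" by auto
  have fub: "(\<integral>\<^sup>+x. g x \<partial>(lborel :: (real ^ 'd) measure))
      = (\<integral>\<^sup>+x. (\<integral>\<^sup>+y. g (\<chi> i. (x(m := y)) i) \<partial>lborel) \<partial>Pi\<^sub>M (UNIV - {m}) ?L)"
    if [measurable]: "g \<in> borel_measurable borel" for g
  proof -
    have "(\<integral>\<^sup>+x. g x \<partial>(lborel :: (real ^ 'd) measure)) = (\<integral>\<^sup>+x. g (\<chi> i. x i) \<partial>Pi\<^sub>M UNIV ?L)"
      by (subst lborel_vec_eq_PiM, subst nn_integral_distr) auto
    also have "\<dots> = (\<integral>\<^sup>+x. g (\<chi> i. x i) \<partial>Pi\<^sub>M (insert m (UNIV - {m})) ?L)"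
      using un by simp
    also have "\<dots> = (\<integral>\<^sup>+x. (\<integral>\<^sup>+y. g (\<chi> i. (x(m := y)) i) \<partial>lborel) \<partial>Pi\<^sub>M (UNIV - {m}) ?L)"
    proof (rule product_nn_integral_insert)
      show "(\<lambda>x. g (\<chi> i. x i)) \<in> borel_measurable (Pi\<^sub>M (insert m (UNIV - {m})) ?L)"
        using un by simp
    qed auto
    finally show ?thesis .
  qed
  have [measurable]: "(\<lambda>x. f (x + (c * x $ k) *\<^sub>R axis m 1)) \<in> borel_measurable borel"
    by measurable
  have m1: "(\<lambda>y. f (\<chi> i. (x(m := y)) i)) \<in> borel_measurable borel" for x
  proof -
    have "(\<lambda>y. (\<chi> i. (x(m := y)) i) :: real ^ 'd) \<in> borel_measurable borel"
      by (rule borel_measurable_vec_lambda) (auto simp: fun_upd_def)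
    then show ?thesis by measurable
  qed
  have shift: "(\<integral>\<^sup>+y. f (\<chi> i. (x(m := y)) i) \<partial>lborel)
      = (\<integral>\<^sup>+y. f (\<chi> i. (x(m := c * x k + y)) i) \<partial>lborel)" for x
    using nn_integral_real_affine[OF m1, of 1 x "c * x k"] by simp
  have "(\<chi> i. (x(m := y)) i) + (c * (\<chi> i. (x(m := y)) i) $ k) *\<^sub>R axis m 1
      = (\<chi> i. (x(m := c * x k + y)) i)" for x and y :: real
    using \<open>m \<noteq> k\<close> by (auto simp: vec_eq_iff axis_def)
  then show ?thesis
    by (subst (1 2) fub) (simp_all only: shift, measurable)
qed

lemma nn_integral_lborel_vec_swap:
  fixes f :: "real ^ 'd \<Rightarrow> ennreal"
  assumes [measurable]: "f \<in> borel_measurable borel" and p: "\<And>i. p (p i) = (i :: 'd)"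
  shows "(\<integral>\<^sup>+x. f (\<chi> i. x $ p i) \<partial>lborel) = (\<integral>\<^sup>+x. f x \<partial>lborel)"
proof -
  have [measurable]: "(\<lambda>x :: real ^ 'd. \<chi> i. x $ p i) \<in> borel_measurable borel"
    by (rule borel_measurable_vec_lambda) simp
  have "(lborel :: (real ^ 'd) measure) = distr lborel borel (\<lambda>x. \<chi> i. x $ p i)"
  proof (rule lborel_eqI)
    fix l u :: "real ^ 'd"
    assume le: "\<And>b. b \<in> Basis \<Longrightarrow> l \<bullet> b \<le> u \<bullet> b"
    have le': "l $ i \<le> u $ i" for i
      using le[of "axis i 1"] by (auto simp: inner_axis Basis_vec_def)
    have vim: "(\<lambda>x :: real ^ 'd. \<chi> i. x $ p i) -` box l u = box (\<chi> i. l $ p i) (\<chi> i. u $ p i)"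
      by (auto simp: mem_box_cart) (metis p)+
    have "emeasure (distr lborel borel (\<lambda>x. \<chi> i. x $ p i)) (box l u)
        = ennreal (\<Prod>i\<in>UNIV. (u - l) $ p i)"
      using le' by (subst emeasure_distr)
        (auto simp: vim emeasure_lborel_box_eq prod_Basis_vec inner_axis, auto simp: Basis_vec_def inner_axis)
    also have "(\<Prod>i\<in>UNIV. (u - l) $ p i) = (\<Prod>i\<in>UNIV. (u - l) $ i)"
      by (rule prod.reindex_bij_witness[of _ p p]) (auto simp: p)
    finally show "emeasure (distr lborel borel (\<lambda>x. \<chi> i. x $ p i)) (box l u)
        = ennreal (\<Prod>b\<in>Basis. (u - l) \<bullet> b)"
      by (simp add: prod_Basis_vec inner_axis)
  qed simp
  then have "(\<integral>\<^sup>+x. f x \<partial>lborel) = (\<integral>\<^sup>+x. f x \<partial>distr lborel borel (\<lambda>x :: real ^ 'd. \<chi> i. x $ p i))"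
    by simp
  also have "\<dots> = (\<integral>\<^sup>+x. f (\<chi> i. x $ p i) \<partial>lborel)"
    by (rule nn_integral_distr) auto
  finally show ?thesis by simp
qed

lemma nn_integral_lborel_vec_diagonal:
  fixes f :: "real ^ 'd \<Rightarrow> ennreal" and A :: "real ^ 'd ^ 'd"
  assumes [measurable]: "f \<in> borel_measurable borel"
    and diag: "\<And>i j. i \<noteq> j \<Longrightarrow> A $ i $ j = 0" and "det A \<noteq> 0"
  shows "(\<integral>\<^sup>+x. f x \<partial>lborel) = ennreal \<bar>det A\<bar> * (\<integral>\<^sup>+x. f (A *v x) \<partial>lborel)"
proof -
  define c where "c b = A $ axis_index b $ axis_index b" for b :: "real ^ 'd"
  have det: "det A = (\<Prod>i\<in>UNIV. A $ i $ i)"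
    using diag by (rule det_diagonal)
  have pr: "(\<Prod>j\<in>(Basis :: (real ^ 'd) set). \<bar>c j\<bar>) = \<bar>det A\<bar>"
    unfolding det abs_prod
    by (simp add: prod_Basis_vec axis_index_axis c_def)
  have nz: "A $ i $ i \<noteq> 0" for i
    using \<open>det A \<noteq> 0\<close> det by auto
  have "(A *v x) = 0 + (\<Sum>j\<in>Basis. (c j * (x \<bullet> j)) *\<^sub>R j)" for x
  proof (rule euclidean_eqI)
    fix b :: "real ^ 'd" assume b: "b \<in> Basis"
    then obtain i where i: "b = axis i 1" by (auto simp: Basis_vec_def)
    have "(A *v x) \<bullet> b = A $ i $ i * x $ i"
      unfolding i by (simp add: inner_axis matrix_vector_mult_def)
        (subst sum.remove[of _ i], auto intro!: sum.neutral simp: diag)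
    also have "\<dots> = c b * (x \<bullet> b)"
      by (simp add: i c_def inner_axis axis_index_axis)
    finally show "(A *v x) \<bullet> b = (0 + (\<Sum>j\<in>Basis. (c j * (x \<bullet> j)) *\<^sub>R j)) \<bullet> b"
      using b by simp
  qed
  then have eq: "(\<lambda>x. 0 + (\<Sum>j\<in>Basis. (c j * (x \<bullet> j)) *\<^sub>R j)) = (*v) A"
    by auto
  have "(\<integral>\<^sup>+x. f x \<partial>lborel) = (\<integral>\<^sup>+x. f x \<partial>density (distr lborel borel ((*v) A)) (\<lambda>_. \<bar>det A\<bar>))"
  proof -
    have "c j \<noteq> 0" if "j \<in> Basis" for j
      using that nz by (auto simp: c_def Basis_vec_def axis_index_axis)
    from lborel_affine_euclidean[of c 0, OF this] show ?thesis
      unfolding eq pr by simp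
  qed
  also have "\<dots> = ennreal \<bar>det A\<bar> * (\<integral>\<^sup>+x. f (A *v x) \<partial>lborel)"
    by (simp add: nn_integral_density nn_integral_distr nn_integral_cmult)
  finally show ?thesis .
qed

text \<open>
  The class of matrices satisfying the formula is closed under products, since determinants
  multiply, so it suffices to treat the elementary matrices: diagonal matrices, transpositions of two
  coordinates and shears. Matrices with a zero row are excluded by the determinant.
\<close>
lemma nn_integral_lborel_vec_linear:
  fixes f :: "real ^ 'd \<Rightarrow> ennreal" and A :: "real ^ 'd ^ 'd"
  assumes "f \<in> borel_measurable borel" and "det A \<noteq> 0"
  shows "(\<integral>\<^sup>+x. f x \<partial>lborel) = ennreal \<bar>det A\<bar> * (\<integral>\<^sup>+x. f (A *v x) \<partial>lborel)"
proof -
  have "det A = 0 \<or> (\<forall>f \<in> borel_measurable borel.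
      (\<integral>\<^sup>+x. f x \<partial>lborel) = ennreal \<bar>det A\<bar> * (\<integral>\<^sup>+x. f (A *v x) \<partial>lborel))"
  proof (induction A rule: induct_matrix_elementary)
    case (1 A B)
    show ?case
    proof (cases "det A = 0 \<or> det B = 0")
      case False
      have "(\<integral>\<^sup>+x. f x \<partial>lborel) = ennreal \<bar>det (A ** B)\<bar> * (\<integral>\<^sup>+x. f ((A ** B) *v x) \<partial>lborel)"
        if [measurable]: "f \<in> borel_measurable borel" for f :: "real ^ 'd \<Rightarrow> ennreal"
      proof -
        have m: "(\<lambda>x. f (A *v x)) \<in> borel_measurable borel" by measurable
        have "(\<integral>\<^sup>+x. f x \<partial>lborel) = ennreal \<bar>det A\<bar> * (\<integral>\<^sup>+x. f (A *v x) \<partial>lborel)"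
          using 1 False that by blast
        also have "(\<integral>\<^sup>+x. f (A *v x) \<partial>lborel) = ennreal \<bar>det B\<bar> * (\<integral>\<^sup>+x. f (A *v (B *v x)) \<partial>lborel)"
          using 1 False m by blast
        finally show ?thesis
          by (simp add: det_mul abs_mult ennreal_mult matrix_vector_mul_assoc mult.assoc)
      qed
      then show ?thesis by blast
    qed (auto simp: det_mul)
  next
    case (2 A i)
    then show ?case using det_zero_row by blast
  next
    case (3 A)
    then show ?case using nn_integral_lborel_vec_diagonal by blast
  next
    case (4 m n)
    let ?p = "Transposition.transpose m n"
    let ?A = "(\<chi> i j. mat 1 $ i $ ?p j) :: real ^ 'd ^ 'd"
    have "?A *v x = (\<chi> i. x $ ?p i)" for x
    proof -
      have "(\<Sum>j\<in>UNIV. (if i = ?p j then 1 else 0) * x $ j) = x $ ?p i" for i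
        by (subst sum.remove[of _ "?p i"]) (auto intro!: sum.neutral split: if_splits)
      then show ?thesis by (simp add: vec_eq_iff matrix_vector_mult_def mat_def)
    qed
    moreover have "\<bar>det ?A\<bar> = 1"
      by (simp add: det_permute_columns permutes_swap_id sign_swap_id abs_mult 4)
    ultimately show ?case
      by (simp add: nn_integral_lborel_vec_swap)
  next
    case (5 m n c)
    let ?A = "(\<chi> i j. if i = m \<and> j = n then c else of_bool (i = j)) :: real ^ 'd ^ 'd"
    have "?A = (\<chi> k. if k = m then row m (mat 1) + c *s row n (mat 1) else row k (mat 1))"
      using 5 by (auto simp: vec_eq_iff row_def mat_def)
    then have "det ?A = 1"
      using det_row_operation[OF 5, of "mat 1 :: real ^ 'd ^ 'd" c] by simp
    moreover have "?A *v x = x + (c * x $ n) *\<^sub>R axis m 1" for x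
    proof -
      have "(\<Sum>j\<in>UNIV. (if i = m \<and> j = n then c else of_bool (i = j)) * x $ j)
          = x $ i + (if i = m then c * x $ n else 0)" for i
      proof (cases "i = m")
        case True
        with 5 show ?thesis
          by (simp add: sum.remove[of _ n] sum.remove[of _ m] cong: if_cong)
      next
        case False
        then show ?thesis
          by (subst sum.remove[of _ i]) (auto intro!: sum.neutral)
      qed
      then show ?thesis by (auto simp: vec_eq_iff matrix_vector_mult_def axis_def)
    qed
    ultimately show ?case
      using 5 by (simp add: nn_integral_lborel_vec_shear)
  qed
  then show ?thesis using assms by blast
qed

lemma lborel_vec_linear:
  fixes A :: "real ^ 'd ^ 'd"
  assumes "det A \<noteq> 0"
  shows "lborel = density (distr lborel borel ((*v) A)) (\<lambda>_. ennreal \<bar>det A\<bar>)"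
proof (rule measure_eqI)
  fix S :: "(real ^ 'd) set" assume "S \<in> sets lborel"
  then have [measurable]: "S \<in> sets borel" by simp
  have "emeasure lborel S = (\<integral>\<^sup>+x. indicator S x \<partial>lborel)"
    by simp
  also have "\<dots> = ennreal \<bar>det A\<bar> * (\<integral>\<^sup>+x. indicator S (A *v x) \<partial>lborel)"
    using assms by (intro nn_integral_lborel_vec_linear) auto
  also have "\<dots> = emeasure (density (distr lborel borel ((*v) A)) (\<lambda>_. ennreal \<bar>det A\<bar>)) S"
    by (simp add: emeasure_density nn_integral_distr nn_integral_cmult del: nn_integral_indicator)
  finally show "emeasure lborel S = emeasure (density (distr lborel borel ((*v) A)) (\<lambda>_. ennreal \<bar>det A\<bar>)) S" .
qed simp

lemma integral_lborel_vec_linear: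
  fixes f :: "real ^ 'd \<Rightarrow> complex" and A :: "real ^ 'd ^ 'd"
  assumes [measurable]: "f \<in> borel_measurable borel" and "det A \<noteq> 0"
  shows "(\<integral>x. f x \<partial>lborel) = \<bar>det A\<bar> *\<^sub>R (\<integral>x. f (A *v x) \<partial>lborel)"
  by (subst lborel_vec_linear[OF \<open>det A \<noteq> 0\<close>]) (simp add: integral_density integral_distr)

text \<open>
  This is the characteristic function of the standard normal distribution after the substitution
  \<open>v = sqrt 3 * x\<close>. The variance 3 is the reciprocal of the limit of \<open>(\<Sum>j\<le>n. j^2) / n^3\<close>.
\<close>
lemma gaussian_cis:
  shows integrable_gaussian_cis: "integrable lborel (\<lambda>v. cis (- (v * w)) * exp (- (v\<^sup>2) / 6))"
    and integral_gaussian_cis: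
      "(\<integral>v. cis (- (v * w)) * exp (- (v\<^sup>2) / 6) \<partial>lborel) = complex_of_real (sqrt (6 * pi) * exp (- 3 / 2 * w\<^sup>2))"
proof -
  let ?f = "\<lambda>v. cis (- (v * w)) * exp (- (v\<^sup>2) / 6)"
  have g: "?f (0 + sqrt 3 * x) = complex_of_real (sqrt (2 * pi)) * (std_normal_density x *\<^sub>R iexp ((- sqrt 3 * w) * x))" for x
    by (simp add: std_normal_density_def cis_conv_exp power_mult_distrib algebra_simps exp_of_real scaleR_conv_of_real)
  interpret N: real_distribution std_normal_distribution by (rule real_dist_normal_dist)
  have "complex_integrable std_normal_distribution (\<lambda>x. iexp ((- sqrt 3 * w) * x))"
    by (intro N.integrable_iexp) auto
  then have i: "integrable lborel (\<lambda>x. std_normal_density x *\<^sub>R iexp ((- sqrt 3 * w) * x))"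
    by (subst (asm) integrable_density) auto
  have "integrable lborel (\<lambda>x. ?f (0 + sqrt 3 * x))"
    unfolding g by (rule integrable_mult_right[OF i])
  then show "integrable lborel ?f"
    by (subst (asm) lborel_integrable_real_affine_iff) auto
  have "(\<integral>v. ?f v \<partial>lborel) = \<bar>sqrt 3\<bar> *\<^sub>R (\<integral>x. ?f (0 + sqrt 3 * x) \<partial>lborel)"
    by (rule lborel_integral_real_affine) simp
  also have "\<dots> = sqrt 3 *\<^sub>R (complex_of_real (sqrt (2 * pi)) * (CLINT x|std_normal_distribution. iexp ((- sqrt 3 * w) * x)))"
    unfolding g integral_mult_right_zero by (subst integral_density) auto
  also have "(CLINT x|std_normal_distribution. iexp ((- sqrt 3 * w) * x)) = exp (- 3 / 2 * w\<^sup>2)"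
    using fun_cong[OF char_std_normal_distribution, of "- sqrt 3 * w"]
    by (simp add: char_def power_mult_distrib)
  finally show "(\<integral>v. ?f v \<partial>lborel) = complex_of_real (sqrt (6 * pi) * exp (- 3 / 2 * w\<^sup>2))"
    by (simp add: real_sqrt_mult[symmetric] scaleR_conv_of_real mult.assoc[symmetric] of_real_mult[symmetric] del: of_real_mult)
qed

section \<open>Whitening a positive definite matrix\<close>

text \<open>
  Gram-Schmidt for the inner product \<open>x \<bullet> (M *v y)\<close>: as long as fewer than \<open>CARD('d)\<close> orthonormal
  vectors have been found, some vector lies outside their span, and its component orthogonal to
  them can be normalised. The orthonormal basis obtained in this way forms the columns of \<open>A\<close>.
\<close>
lemma positive_definite_imp_whitening:
  fixes M :: "real ^ 'd ^ 'd"
  assumes "positive_definite M"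
  obtains A :: "real ^ 'd ^ 'd" where "transpose A ** M ** A = mat 1"
proof -
  define B where "B x y = x \<bullet> (M *v y)" for x y :: "real ^ 'd"
  have sym: "B x y = B y x" for x y
    using assms unfolding B_def positive_definite_def
    by (metis dot_lmul_matrix inner_commute transpose_matrix_vector)
  have pos: "B x x > 0" if "x \<noteq> 0" for x
    using assms that unfolding B_def positive_definite_def by blast
  have lin: "B x (y + z) = B x y + B x z" "B x (y - z) = B x y - B x z" "B x (c *\<^sub>R y) = c * B x y"
    "B (y - z) x = B y x - B z x" "B (c *\<^sub>R y) x = c * B y x" for x y z c
    unfolding B_def by (simp_all add: algebra_simps inner_simps matrix_vector_mult_scaleR)
  have linsum: "B x (\<Sum>i\<in>S. f i) = (\<Sum>i\<in>S. B x (f i))" for x S and f :: "'d \<Rightarrow> real ^ 'd"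
    unfolding B_def by (simp add: linear_sum[OF matrix_vector_mul_linear] inner_sum_right)
  have "finite S \<Longrightarrow> \<exists>v :: 'd \<Rightarrow> real ^ 'd. \<forall>i\<in>S. \<forall>j\<in>S. B (v i) (v j) = of_bool (i = j)" for S :: "'d set"
  proof (induction S rule: finite_induct)
    case (insert k S)
    then obtain v :: "'d \<Rightarrow> real ^ 'd" where v: "\<forall>i\<in>S. \<forall>j\<in>S. B (v i) (v j) = of_bool (i = j)" by blast
    have "card S < CARD('d)"
      using insert.hyps by (intro psubset_card_mono) auto
    moreover have "dim (v ` S) \<le> card S"
      using dim_le_card'[of "v ` S"] card_image_le[of S v] by simp
    ultimately have "dim (v ` S) < DIM(real ^ 'd)" by simp
    then have "span (v ` S) \<noteq> UNIV"
      by (metis dim_span dim_UNIV less_irrefl)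
    then obtain w where w: "w \<notin> span (v ` S)" by blast
    define p where "p = w - (\<Sum>i\<in>S. B (v i) w *\<^sub>R v i)"
    have "(\<Sum>i\<in>S. B (v i) w *\<^sub>R v i) \<in> span (v ` S)"
      by (intro span_sum span_scale span_base) auto
    then have p0: "p \<noteq> 0" using w unfolding p_def by auto
    have orth: "B (v j) p = 0" if "j \<in> S" for j
    proof -
      have "B (v j) p = B (v j) w - (\<Sum>i\<in>S. B (v i) w * B (v j) (v i))"
        by (simp add: p_def lin linsum)
      also have "(\<Sum>i\<in>S. B (v i) w * B (v j) (v i)) = B (v j) w"
        using v that insert.hyps by (subst sum.remove[of _ j]) (auto intro!: sum.neutral)
      finally show ?thesis by simp
    qed
    define q where "q = (1 / sqrt (B p p)) *\<^sub>R p"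
    have "B q q = 1" using pos[OF p0] by (simp add: q_def lin)
    moreover have "B (v j) q = 0" "B q (v j) = 0" if "j \<in> S" for j
      using orth[OF that] sym by (auto simp: q_def lin)
    ultimately show ?case
      using v insert.hyps by (intro exI[of _ "v(k := q)"]) auto
  qed auto
  from this[of UNIV] obtain v :: "'d \<Rightarrow> real ^ 'd" where v: "\<And>i j. B (v i) (v j) = of_bool (i = j)" by auto
  define A where "A = (\<chi> r c. v c $ r)"
  have col: "A *v axis j 1 = v j" for j
    by (simp add: vec_eq_iff A_def matrix_vector_mult_basis column_def)
  have "(transpose A ** M ** A) $ i $ j = B (v i) (v j)" for i j
  proof -
    have "(transpose A ** M ** A) $ i $ j = axis i 1 \<bullet> ((transpose A ** M ** A) *v axis j 1)"
      by (simp add: inner_axis' matrix_vector_mult_basis column_def)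
    also have "\<dots> = axis i 1 \<bullet> (transpose A *v (M *v v j))"
      by (simp add: matrix_vector_mul_assoc[symmetric] col)
    also have "\<dots> = B (v i) (v j)"
      by (metis B_def col dot_lmul_matrix transpose_matrix_vector transpose_transpose)
    finally show ?thesis .
  qed
  then have "transpose A ** M ** A = mat 1"
    by (simp add: vec_eq_iff mat_def v)
  then show ?thesis by (rule that)
qed

lemma
  fixes A M :: "real ^ 'd ^ 'd"
  assumes A: "transpose A ** M ** A = mat 1"
  shows whitening_det: "(det A)\<^sup>2 * det M = 1"
    and whitening_inv: "matrix_inv M = A ** transpose A"
    and whitening_form: "(A *v v) \<bullet> (M *v (A *v v)) = (norm v)\<^sup>2"
proof -
  have "det (transpose A ** M ** A) = 1" by (simp add: A)
  then show d: "(det A)\<^sup>2 * det M = 1"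
    by (simp add: det_mul power2_eq_square mult_ac)
  then have "invertible A" "invertible M" by (auto simp: invertible_det_nz)
  have "(A ** transpose A) ** M = mat 1"
  proof -
    have "A ** (transpose A ** M) = mat 1"
      using A matrix_left_right_inverse by blast
    then show ?thesis by (simp add: matrix_mul_assoc)
  qed
  moreover from this have "M ** (A ** transpose A) = mat 1"
    using matrix_left_right_inverse by blast
  ultimately show "matrix_inv M = A ** transpose A"
    unfolding matrix_inv_def
    by (intro some_equality conjI) (metis matrix_mul_assoc matrix_mul_lid matrix_mul_rid)+
  have "(A *v v) \<bullet> (M *v (A *v v)) = v \<bullet> ((transpose A ** M ** A) *v v)"
    by (metis dot_lmul_matrix matrix_vector_mul_assoc transpose_matrix_vector transpose_transpose)
  then show "(A *v v) \<bullet> (M *v (A *v v)) = (norm v)\<^sup>2"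
    by (simp add: A power2_norm_eq_inner)
qed

text \<open>
  Expressing the density by a whitening matrix avoids both the inverse and the determinant of \<open>M\<close>;
  under the change of lattice coordinates \<open>H\<close>, the whitening matrix is simply multiplied by
  the transpose of \<open>H\<close>.
\<close>
lemma gauss_density_whitening:
  fixes A M :: "real ^ 'd ^ 'd"
  assumes A: "transpose A ** M ** A = mat 1"
  shows "gauss_density M x
    = \<bar>det A\<bar> * (3 / (2 * pi)) powr (real CARD('d) / 2) * exp (- 3 / 2 * (norm (transpose A *v x))\<^sup>2)"
proof -
  let ?d = "real CARD('d)"
  have dA: "det A \<noteq> 0" using whitening_det[OF A] by auto
  have "det M = 1 / (det A)\<^sup>2"
    using whitening_det[OF A] dA by (simp add: field_simps)
  then have "sqrt (det M) = 1 / \<bar>det A\<bar>"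
    by (simp add: real_sqrt_divide)
  moreover have "det ((1 / 3) *\<^sub>R M) = (1 / 3) ^ CARD('d) * det M"
    using det_rows_mul[of "\<lambda>_. 1 / 3" "\<lambda>i. M $ i"] by (simp add: vec_eq_iff[symmetric] scaleR_vec_def vector_scalar_mult_def)
  moreover have "sqrt ((1 / 3) ^ CARD('d)) = 1 / 3 powr (?d / 2)"
    by (simp add: real_sqrt_power[symmetric] real_sqrt_divide power_divide powr_half_sqrt[symmetric] powr_powr powr_realpow[symmetric])
  ultimately have s: "sqrt (det ((1 / 3) *\<^sub>R M)) = 1 / (3 powr (?d / 2) * \<bar>det A\<bar>)"
    by (simp add: real_sqrt_mult)
  have q: "x \<bullet> (matrix_inv M *v x) = (norm (transpose A *v x))\<^sup>2"
    unfolding whitening_inv[OF A] power2_norm_eq_inner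
    by (metis dot_lmul_matrix matrix_vector_mul_assoc transpose_matrix_vector)
  show ?thesis
    unfolding gauss_density_def s q by (simp add: powr_divide powr_mult)
qed

text \<open>
  The covariance matrix is a Bochner integral of rank-one matrices, and \<open>A |-> x \<bullet> (A *v x)\<close> is a
  bounded linear functional, so it may be moved inside the integral.
\<close>
lemma cov_matrix_form:
  fixes Y :: "'w \<Rightarrow> real ^ 'd"
  assumes "prob_space P" and [measurable]: "Y \<in> borel_measurable P"
    and "integrable P (\<lambda>w. (norm (Y w))\<^sup>2)"
  shows "x \<bullet> (cov_matrix P Y *v x) = (\<integral>w. (x \<bullet> (Y w - integral\<^sup>L P Y))\<^sup>2 \<partial>P)"
proof -
  interpret prob_space P by fact
  define C where "C w = Y w - integral\<^sup>L P Y" for w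
  let ?T = "\<lambda>y :: real ^ 'd. (columnvector y :: real ^ 1 ^ 'd) ** rowvector y"
  have T: "?T y $ i $ j = y $ i * y $ j" for y i j
    by (simp add: matrix_matrix_mult_def columnvector_def rowvector_def)
  have mC [measurable]: "C \<in> borel_measurable P" by (simp add: C_def[abs_def])
  have sq: "integrable P (\<lambda>w. (norm (C w))\<^sup>2)"
  proof (rule Bochner_Integration.integrable_bound)
    show "integrable P (\<lambda>w. 2 * (norm (Y w))\<^sup>2 + 2 * (norm (integral\<^sup>L P Y))\<^sup>2)"
      using assms by auto
    show "AE w in P. norm ((norm (C w))\<^sup>2) \<le> norm (2 * (norm (Y w))\<^sup>2 + 2 * (norm (integral\<^sup>L P Y))\<^sup>2)"
      by (auto simp: C_def norm_diff_square_le)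
  qed simp
  have mC_nth [measurable]: "(\<lambda>w. C w $ i) \<in> borel_measurable P" for i
    unfolding cart_eq_inner_axis by measurable
  have mT: "(\<lambda>w. ?T (C w)) \<in> borel_measurable P"
    by (subst borel_measurable_euclidean_space)
       (auto simp: Basis_vec_def inner_axis T intro!: borel_measurable_times borel_measurable_inner)
  have "integrable P (\<lambda>w. ?T (C w))"
  proof (rule Bochner_Integration.integrable_bound)
    show "integrable P (\<lambda>w. (real CARD('d))\<^sup>2 * (norm (C w))\<^sup>2)"
      using sq by simp
    have "norm (?T y) \<le> (real CARD('d))\<^sup>2 * (norm y)\<^sup>2" for y :: "real ^ 'd"
    proof -
      have "norm (?T y) \<le> (\<Sum>i\<in>UNIV. norm (?T y $ i))"
        by (simp add: norm_vec_def L2_set_le_sum)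
      also have "\<dots> \<le> (\<Sum>i\<in>(UNIV :: 'd set). \<Sum>j\<in>(UNIV :: 'd set). \<bar>?T y $ i $ j\<bar>)"
        by (intro sum_mono norm_le_l1_cart)
      also have "\<dots> \<le> (\<Sum>i\<in>(UNIV :: 'd set). \<Sum>j\<in>(UNIV :: 'd set). (norm y)\<^sup>2)"
        by (intro sum_mono) (auto simp: T abs_mult power2_eq_square intro!: mult_mono component_le_norm_cart)
      finally show ?thesis by (simp add: power2_eq_square)
    qed
    then show "AE w in P. norm (?T (C w)) \<le> norm ((real CARD('d))\<^sup>2 * (norm (C w))\<^sup>2)"
      by auto
  qed (rule mT)
  then have iT: "integrable P (\<lambda>w. ?T (C w))" .
  have bl: "bounded_linear (\<lambda>A :: real ^ 'd ^ 'd. x \<bullet> (A *v x))"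
  proof (rule linear_conv_bounded_linear[THEN iffD1])
    show "linear (\<lambda>A :: real ^ 'd ^ 'd. x \<bullet> (A *v x))"
      by (rule linearI) (simp_all add: matrix_vector_mult_add_rdistrib inner_add_right scaleR_matrix_vector_assoc[symmetric])
  qed
  have form: "x \<bullet> (?T y *v x) = (x \<bullet> y)\<^sup>2" for y
    by (simp add: inner_vec_def matrix_vector_mult_def T power2_eq_square sum_product sum_distrib_left mult_ac)
  have "x \<bullet> (cov_matrix P Y *v x) = x \<bullet> ((\<integral>w. ?T (C w) \<partial>P) *v x)"
    by (simp add: cov_matrix_def Let_def C_def)
  also have "\<dots> = (\<integral>w. x \<bullet> (?T (C w) *v x) \<partial>P)"
    by (rule integral_bounded_linear[OF bl iT, symmetric])
  finally show ?thesis by (simp add: form C_def)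
qed

section \<open>Characteristic functions and the defect of their modulus\<close>

text \<open>
  If \<open>V = Y - Y'\<close> for independent copies \<open>Y\<close>, \<open>Y'\<close>, this is the amount by which the squared modulus of
  the characteristic function of \<open>Y\<close> falls short of 1, see \<open>norm_char_fun_eq_gap\<close>.
\<close>
definition gap :: "'w measure \<Rightarrow> ('w \<Rightarrow> 'a :: euclidean_space) \<Rightarrow> 'a \<Rightarrow> real" where
  "gap P V t = (\<integral>w. 1 - cos (t \<bullet> V w) \<partial>P)"

definition char_fun :: "'w measure \<Rightarrow> ('w \<Rightarrow> 'a :: euclidean_space) \<Rightarrow> 'a \<Rightarrow> complex" where
  "char_fun P Y t = (\<integral>w. cis (t \<bullet> Y w) \<partial>P)"

lemma borel_measurable_cis [measurable (raw)]:
  "f \<in> borel_measurable M \<Longrightarrow> (\<lambda>x. cis (f x)) \<in> borel_measurable M"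
  by (rule borel_measurable_continuous_on[where f = cis]) (auto intro!: continuous_intros)

context prob_space
begin

lemma integrable_one_minus_cos:
  fixes V :: "'a \<Rightarrow> 'b :: euclidean_space"
  assumes [measurable]: "V \<in> borel_measurable M"
  shows "integrable M (\<lambda>w. 1 - cos (t \<bullet> V w :: real))"
proof (rule integrable_const_bound[where B = 2])
  have "\<bar>1 - cos y\<bar> \<le> 2" for y :: real
    using cos_ge_minus_one[of y] cos_le_one[of y] by linarith
  then show "AE w in M. norm (1 - cos (t \<bullet> V w)) \<le> 2" by auto
qed simp

lemma integrable_cis:
  fixes V :: "'a \<Rightarrow> 'b :: euclidean_space"
  assumes [measurable]: "V \<in> borel_measurable M"
  shows "integrable M (\<lambda>w. cis (t \<bullet> V w))"
  by (rule integrable_const_bound[where B = 1]) auto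

lemma gap_nonneg: "0 \<le> gap M V t"
  unfolding gap_def by (rule Bochner_Integration.integral_nonneg) simp

text \<open>
  With \<open>1 - cos x = 2 (sin (x/2))^2\<close> this is the subadditivity of \<open>\<bar>sin\<bar>\<close>, squared. It says that
  differences of near-periods of the step distribution are again near-periods.
\<close>
lemma gap_diff_le:
  fixes V :: "'a \<Rightarrow> 'b :: euclidean_space"
  assumes [measurable]: "V \<in> borel_measurable M"
  shows "gap M V (s - t) \<le> 2 * gap M V s + 2 * gap M V t"
proof -
  have trig: "1 - cos (a - b) \<le> 2 * (1 - cos a) + 2 * (1 - cos b)" for a b :: real
  proof -
    have h: "1 - cos x = 2 * (sin (x / 2))\<^sup>2" for x :: real
      using cos_double_sin[of "x / 2"] by simp
    have "\<bar>sin (a / 2 - b / 2)\<bar> \<le> \<bar>sin (a / 2)\<bar> * \<bar>cos (b / 2)\<bar> + \<bar>cos (a / 2)\<bar> * \<bar>sin (b / 2)\<bar>"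
      unfolding sin_diff abs_mult[symmetric] by (rule abs_triangle_ineq4)
    also have "\<dots> \<le> \<bar>sin (a / 2)\<bar> * 1 + 1 * \<bar>sin (b / 2)\<bar>"
      by (intro add_mono mult_mono) auto
    finally have "(sin (a / 2 - b / 2))\<^sup>2 \<le> (\<bar>sin (a / 2)\<bar> + \<bar>sin (b / 2)\<bar>)\<^sup>2"
      by (intro power2_le_iff_abs_le[THEN iffD2]) auto
    also have "\<dots> \<le> 2 * (sin (a / 2))\<^sup>2 + 2 * (sin (b / 2))\<^sup>2"
      using sum_squares_bound[of "\<bar>sin (a / 2)\<bar>" "\<bar>sin (b / 2)\<bar>"] by (simp add: power2_sum)
    finally show ?thesis by (simp add: h diff_divide_distrib)
  qed
  let ?f = "\<lambda>s w. 1 - cos (s \<bullet> V w)"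
  have int: "integrable M (?f s)" for s by (rule integrable_one_minus_cos) simp
  have "gap M V (s - t) \<le> (\<integral>w. 2 * ?f s w + 2 * ?f t w \<partial>M)"
    unfolding gap_def
  proof (rule integral_mono[OF int])
    show "integrable M (\<lambda>w. 2 * ?f s w + 2 * ?f t w)"
      by (intro Bochner_Integration.integrable_add integrable_mult_right int)
    show "?f (s - t) w \<le> 2 * ?f s w + 2 * ?f t w" for w
      using trig by (simp only: inner_diff_left)
  qed
  also have "\<dots> = 2 * gap M V s + 2 * gap M V t"
    unfolding gap_def
    using Bochner_Integration.integral_add[OF integrable_mult_right[OF int] integrable_mult_right[OF int], of 2 s 2 t]
    by (simp only: integral_mult_right_zero)
  finally show ?thesis .
qed

lemma continuous_gap:
  fixes V :: "'a \<Rightarrow> 'b :: euclidean_space"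
  assumes [measurable]: "V \<in> borel_measurable M"
  shows "continuous_on S (gap M V)"
proof -
  have "isCont (gap M V) t" for t
    unfolding continuous_at_sequentially
  proof (intro allI impI)
    fix x assume x: "x \<longlonglongrightarrow> t"
    have "(\<lambda>n. \<integral>w. 1 - cos (x n \<bullet> V w) \<partial>M) \<longlonglongrightarrow> (\<integral>w. 1 - cos (t \<bullet> V w) \<partial>M)"
    proof (rule integral_dominated_convergence[where w = "\<lambda>_. 2"])
      show "AE w in M. (\<lambda>n. 1 - cos (x n \<bullet> V w)) \<longlonglongrightarrow> 1 - cos (t \<bullet> V w)"
        by (intro AE_I2 tendsto_intros x)
      have "\<bar>1 - cos y\<bar> \<le> 2" for y :: real
        using cos_ge_minus_one[of y] cos_le_one[of y] by linarith
      then show "AE w in M. norm (1 - cos (x n \<bullet> V w)) \<le> 2" for n by auto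
    qed auto
    then show "(gap M V \<circ> x) \<longlonglongrightarrow> gap M V t"
      by (simp add: gap_def comp_def)
  qed
  then show ?thesis by (rule continuous_at_imp_continuous_on[rule_format])
qed

text \<open>
  Since \<open>1 - cos x \<ge> x^2 / 4\<close> for \<open>\<bar>x\<bar> \<le> 1\<close>, the gap dominates a quarter of the second moment of \<open>t \<bullet> V\<close>
  restricted to \<open>norm V \<le> R\<close> as soon as \<open>norm t \<le> 1 / R\<close>. For large \<open>R\<close> the truncation costs at most
  half of the second moment, uniformly in the direction of \<open>t\<close>.
\<close>
lemma gap_quadratic_lower_bound:
  fixes V :: "'a \<Rightarrow> 'b :: euclidean_space"
  assumes [measurable]: "V \<in> borel_measurable M"
    and int: "integrable M (\<lambda>w. (norm (V w))\<^sup>2)"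
    and "\<kappa> > 0" and \<kappa>: "\<And>t. \<kappa> * (norm t)\<^sup>2 \<le> (\<integral>w. (t \<bullet> V w)\<^sup>2 \<partial>M)"
  obtains c \<delta> where "c > 0" "\<delta> > 0" "\<And>t. norm t \<le> \<delta> \<Longrightarrow> c * (norm t)\<^sup>2 \<le> gap M V t"
proof -
  let ?T = "\<lambda>R w. (norm (V w))\<^sup>2 * indicat_real {w. norm (V w) > R} w"
  have mT [measurable]: "?T R \<in> borel_measurable M" for R
    by measurable
  have "(\<lambda>n. \<integral>w. ?T (real n) w \<partial>M) \<longlonglongrightarrow> (\<integral>w. 0 \<partial>M)"
  proof (rule integral_dominated_convergence[OF _ _ int])
    show "AE w in M. (\<lambda>n. ?T (real n) w) \<longlonglongrightarrow> 0"
    proof (rule AE_I2)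
      fix w
      obtain N where "norm (V w) \<le> real N" using real_arch_simple by blast
      then have "eventually (\<lambda>n. ?T (real n) w = 0) sequentially"
        by (intro eventually_sequentiallyI[of N]) (auto simp: indicator_def)
      then show "(\<lambda>n. ?T (real n) w) \<longlonglongrightarrow> 0" by (rule tendsto_eventually)
    qed
  qed (auto simp: indicator_def)
  then have "eventually (\<lambda>n. (\<integral>w. ?T (real n) w \<partial>M) < \<kappa> / 2) sequentially"
    by (rule order_tendstoD) (use \<open>\<kappa> > 0\<close> in simp)
  with eventually_gt_at_top[of 0] have "eventually (\<lambda>n. (\<integral>w. ?T (real n) w \<partial>M) < \<kappa> / 2 \<and> 0 < n) sequentially"
    by (rule eventually_elim2) simp
  then obtain n where n: "(\<integral>w. ?T (real n) w \<partial>M) < \<kappa> / 2" "0 < n"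
    by (auto simp: eventually_sequentially)
  have intT: "integrable M (?T (real n))"
    by (rule Bochner_Integration.integrable_bound[OF int]) (auto simp: indicator_def)
  show ?thesis
  proof (rule that[of "\<kappa> / 8" "1 / real n"])
    fix t :: 'b assume t: "norm t \<le> 1 / real n"
    have cosb: "x\<^sup>2 / 4 \<le> 1 - cos x" if "\<bar>x\<bar> \<le> 1" for x :: real
    proof -
      have "\<bar>Re (iexp x - (\<Sum>k\<le>3. (\<i> * x) ^ k / fact k))\<bar> \<le> \<bar>x\<bar> ^ 4 / 24"
        using order_trans[OF abs_Re_le_cmod iexp_approx1[of x 3]] by (simp add: fact_numeral)
      moreover have "Re (iexp x - (\<Sum>k\<le>3. (\<i> * x) ^ k / fact k)) = cos x - (1 - x\<^sup>2 / 2)"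
        by (simp add: numeral_eq_Suc cis_conv_exp[symmetric] field_simps)
      moreover have "\<bar>x\<bar> ^ 4 \<le> x\<^sup>2"
        using power_decreasing[of 2 4 "\<bar>x\<bar>"] that by simp
      ultimately show ?thesis by linarith
    qed
    have int2: "integrable M (\<lambda>w. (t \<bullet> V w)\<^sup>2)"
    proof (rule Bochner_Integration.integrable_bound)
      show "integrable M (\<lambda>w. (norm t)\<^sup>2 * (norm (V w))\<^sup>2)" using int by simp
      show "AE w in M. norm ((t \<bullet> V w)\<^sup>2) \<le> norm ((norm t)\<^sup>2 * (norm (V w))\<^sup>2)"
        by (auto simp: inner_square_le)
    qed simp
    have "\<kappa> / 8 * (norm t)\<^sup>2 = 1 / 4 * (\<kappa> * (norm t)\<^sup>2 - (norm t)\<^sup>2 * (\<kappa> / 2))"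
      by (simp add: field_simps)
    also have "\<dots> \<le> 1 / 4 * ((\<integral>w. (t \<bullet> V w)\<^sup>2 \<partial>M) - (norm t)\<^sup>2 * (\<integral>w. ?T (real n) w \<partial>M))"
      using n \<kappa>[of t] by (intro mult_left_mono diff_mono) auto
    also have "\<dots> = (\<integral>w. 1 / 4 * ((t \<bullet> V w)\<^sup>2 - (norm t)\<^sup>2 * ?T (real n) w) \<partial>M)"
      using int2 intT by simp
    also have "\<dots> \<le> gap M V t"
      unfolding gap_def
    proof (rule integral_mono)
      show "integrable M (\<lambda>w. 1 / 4 * ((t \<bullet> V w)\<^sup>2 - (norm t)\<^sup>2 * ?T (real n) w))"
        using int2 intT by simp
      show "integrable M (\<lambda>w. 1 - cos (t \<bullet> V w))" by (rule integrable_one_minus_cos) simp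
      fix w
      show "1 / 4 * ((t \<bullet> V w)\<^sup>2 - (norm t)\<^sup>2 * ?T (real n) w) \<le> 1 - cos (t \<bullet> V w)"
      proof (cases "norm (V w) > real n")
        case True
        have "1 / 4 * ((t \<bullet> V w)\<^sup>2 - (norm t)\<^sup>2 * ?T (real n) w) \<le> 0"
          using True inner_square_le[of t "V w"] by simp
        then show ?thesis using cos_le_one[of "t \<bullet> V w"] by linarith
      next
        case False
        have "\<bar>t \<bullet> V w\<bar> \<le> norm t * norm (V w)" by (rule Cauchy_Schwarz_ineq2)
        also have "\<dots> \<le> 1 / real n * real n" using False t by (intro mult_mono) auto
        finally have "\<bar>t \<bullet> V w\<bar> \<le> 1" using n by simp
        from cosb[OF this] False show ?thesis by simp
      qed
    qed
    finally show "\<kappa> / 8 * (norm t)\<^sup>2 \<le> gap M V t" .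
  qed (use \<open>\<kappa> > 0\<close> n in auto)
qed

text \<open>
  This is the estimate that handles the weights. The multiples \<open>j t\<close> may come back to points where
  the gap vanishes, but one chooses \<open>k \<le> n/2\<close> such that \<open>k t\<close> lies in the cube at distance at least
  \<open>r\<close> from the origin: \<open>k = 1\<close> if \<open>t\<close> is itself that large, and otherwise the first multiple leaving the
  ball of radius \<open>r\<close>, which is reached early enough because \<open>norm t \<ge> \<delta> / n\<close>. The gap at \<open>k t\<close> is at
  least some \<open>e > 0\<close> by compactness, and \<open>gap_diff_le\<close> shares it among \<open>j t\<close> and \<open>(j + k) t\<close>.
  Summing over the \<open>n - k \<ge> n/2\<close> pairs gives a bound linear in \<open>n\<close>.
\<close>
lemma sum_gap_lower_bound:
  fixes V :: "'a \<Rightarrow> real ^ 'd"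
  assumes [measurable]: "V \<in> borel_measurable M"
    and pos: "\<And>t. (\<And>i. \<bar>t $ i\<bar> \<le> pi) \<Longrightarrow> t \<noteq> 0 \<Longrightarrow> 0 < gap M V t"
    and "\<delta> > 0"
  obtains \<eta> where "\<eta> > 0"
    "\<And>n t. 4 \<le> n \<Longrightarrow> (\<And>i. \<bar>t $ i\<bar> \<le> pi) \<Longrightarrow> \<delta> / real n \<le> norm t \<Longrightarrow>
       \<eta> * real n \<le> (\<Sum>j=1..n. gap M V (real j *\<^sub>R t))"
proof -
  \<comment> \<open>\<open>r \<le> \<delta> / 4\<close> keeps \<open>k \<le> n / 2\<close>, and \<open>r \<le> 1\<close> keeps a vector of norm below \<open>2 * r\<close> inside the cube\<close>
  define r where "r = min (\<delta> / 4) 1"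
  have r: "0 < r" "r \<le> \<delta> / 4" "r \<le> 1" using \<open>\<delta> > 0\<close> by (auto simp: r_def)
  define K where "K = cbox (\<chi> i. - pi) (\<chi> i. pi) - ball (0 :: real ^ 'd) r"
  have K: "v \<in> K \<longleftrightarrow> (\<forall>i. \<bar>v $ i\<bar> \<le> pi) \<and> r \<le> norm v" for v
    by (auto simp: K_def mem_box_cart abs_le_iff minus_le_iff)
  have "compact K" unfolding K_def by (intro compact_diff) auto
  have "\<exists>e>0. \<forall>v\<in>K. e \<le> gap M V v"
  proof (cases "K = {}")
    case False
    then obtain v where v: "v \<in> K" "\<forall>y\<in>K. gap M V v \<le> gap M V y"
      using continuous_attains_inf[OF \<open>compact K\<close> _ continuous_gap[of V]] assms(1) by auto
    then have "0 < gap M V v" using r by (intro pos) (auto simp: K)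
    then show ?thesis using v by auto
  qed (auto intro: exI[of _ 1])
  then obtain e where e: "e > 0" "\<And>v. v \<in> K \<Longrightarrow> e \<le> gap M V v" by auto
  show ?thesis
  proof (rule that[of "e / 8"])
    fix n :: nat and t :: "real ^ 'd"
    assume n: "4 \<le> n" and cube: "\<And>i. \<bar>t $ i\<bar> \<le> pi" and t: "\<delta> / real n \<le> norm t"
    have t0: "0 < norm t" using t \<open>\<delta> > 0\<close> n by (intro less_le_trans[OF _ t]) auto
    have "\<exists>k\<ge>1. 2 * k \<le> n \<and> real k *\<^sub>R t \<in> K"
    proof (cases "r \<le> norm t")
      case True
      then show ?thesis using n cube by (intro exI[of _ 1]) (auto simp: K)
    next
      case False
      define k where "k = nat \<lceil>r / norm t\<rceil>"
      have "0 < r / norm t" using r t0 by simp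
      then have k: "r / norm t \<le> real k" "real k < r / norm t + 1" "k \<ge> 1"
        unfolding k_def by linarith+
      have lo: "r \<le> real k * norm t" using k(1) t0 by (simp only: pos_divide_le_eq)
      have "real k * norm t < (r / norm t + 1) * norm t" using k(2) t0 by (rule mult_strict_right_mono)
      also have "\<dots> = r + norm t" using t0 by (simp add: distrib_right)
      finally have hi: "real k * norm t \<le> 2" using False r by linarith
      have "r / norm t \<le> r / (\<delta> / real n)"
        using t \<open>\<delta> > 0\<close> n r t0 by (intro divide_left_mono) auto
      also have "\<dots> = r * real n / \<delta>" by simp
      also have "\<dots> \<le> (\<delta> / 4) * real n / \<delta>"
        using r \<open>\<delta> > 0\<close> by (intro divide_right_mono mult_right_mono) auto
      also have "\<dots> = real n / 4" using \<open>\<delta> > 0\<close> by simp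
      finally have "2 * real k < real n / 2 + 2" using k(2) by linarith
      also have "\<dots> \<le> real n" using n by simp
      finally have "2 * k \<le> n" by simp
      moreover have "real k *\<^sub>R t \<in> K"
        unfolding K
      proof (intro conjI allI)
        fix i
        have "\<bar>(real k *\<^sub>R t) $ i\<bar> \<le> norm (real k *\<^sub>R t)" by (rule component_le_norm_cart)
        also have "\<dots> \<le> pi" using hi pi_ge_two by simp
        finally show "\<bar>(real k *\<^sub>R t) $ i\<bar> \<le> pi" .
        show "r \<le> norm (real k *\<^sub>R t)" using lo by simp
      qed
      ultimately show ?thesis using k(3) by blast
    qed
    then obtain k where k: "1 \<le> k" "2 * k \<le> n" "real k *\<^sub>R t \<in> K" by blast
    have step: "e \<le> 2 * gap M V (real (j + k) *\<^sub>R t) + 2 * gap M V (real j *\<^sub>R t)" for j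
    proof -
      have "e \<le> gap M V (real (j + k) *\<^sub>R t - real j *\<^sub>R t)"
        using e(2)[OF k(3)] by (simp add: algebra_simps)
      also have "\<dots> \<le> 2 * gap M V (real (j + k) *\<^sub>R t) + 2 * gap M V (real j *\<^sub>R t)"
        by (rule gap_diff_le) simp
      finally show ?thesis .
    qed
    have "e * (real n / 2) \<le> e * real (n - k)"
      using k(2) e(1) by (intro mult_left_mono) (auto simp: of_nat_diff)
    also have "\<dots> = (\<Sum>j=1..n-k. e)" by simp
    also have "\<dots> \<le> (\<Sum>j=1..n-k. 2 * gap M V (real (j + k) *\<^sub>R t) + 2 * gap M V (real j *\<^sub>R t))"
      by (intro sum_mono step)
    also have "\<dots> = 2 * (\<Sum>j=1..n-k. gap M V (real (j + k) *\<^sub>R t)) + 2 * (\<Sum>j=1..n-k. gap M V (real j *\<^sub>R t))"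
      by (simp add: sum.distrib sum_distrib_left)
    finally have le: "e * (real n / 2) \<le>
      2 * (\<Sum>j=1..n-k. gap M V (real (j + k) *\<^sub>R t)) + 2 * (\<Sum>j=1..n-k. gap M V (real j *\<^sub>R t))" .
    have "(\<Sum>j=1..n-k. gap M V (real (j + k) *\<^sub>R t)) = (\<Sum>j=1+k..n. gap M V (real j *\<^sub>R t))"
      using k by (intro sum.reindex_bij_witness[of _ "\<lambda>j. j - k" "\<lambda>j. j + k"]) auto
    also have "\<dots> \<le> (\<Sum>j=1..n. gap M V (real j *\<^sub>R t))"
      by (intro sum_mono2) (auto simp: gap_nonneg)
    finally have 1: "(\<Sum>j=1..n-k. gap M V (real (j + k) *\<^sub>R t)) \<le> (\<Sum>j=1..n. gap M V (real j *\<^sub>R t))" .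
    have 2: "(\<Sum>j=1..n-k. gap M V (real j *\<^sub>R t)) \<le> (\<Sum>j=1..n. gap M V (real j *\<^sub>R t))"
      by (intro sum_mono2) (auto simp: gap_nonneg)
    from le 1 2 have "e * (real n / 2) \<le> 4 * (\<Sum>j=1..n. gap M V (real j *\<^sub>R t))"
      by linarith
    then show "e / 8 * real n \<le> (\<Sum>j=1..n. gap M V (real j *\<^sub>R t))" by linarith
  qed (use e in auto)
qed

lemma continuous_char_fun:
  fixes V :: "'a \<Rightarrow> 'b :: euclidean_space"
  assumes [measurable]: "V \<in> borel_measurable M"
  shows "continuous_on S (char_fun M V)"
proof -
  have "isCont (char_fun M V) t" for t
    unfolding continuous_at_sequentially
  proof (intro allI impI)
    fix x assume x: "x \<longlonglongrightarrow> t"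
    have "(\<lambda>n. \<integral>w. cis (x n \<bullet> V w) \<partial>M) \<longlonglongrightarrow> (\<integral>w. cis (t \<bullet> V w) \<partial>M)"
    proof (rule integral_dominated_convergence[where w = "\<lambda>_. 1"])
      show "AE w in M. (\<lambda>n. cis (x n \<bullet> V w)) \<longlonglongrightarrow> cis (t \<bullet> V w)"
        by (intro AE_I2 tendsto_intros x)
    qed auto
    then show "(char_fun M V \<circ> x) \<longlonglongrightarrow> char_fun M V t"
      by (simp add: char_fun_def comp_def)
  qed
  then show ?thesis by (rule continuous_at_imp_continuous_on[rule_format])
qed

lemma norm_char_fun_le_1:
  fixes V :: "'a \<Rightarrow> 'b :: euclidean_space"
  assumes [measurable]: "V \<in> borel_measurable M"
  shows "norm (char_fun M V t) \<le> 1"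
  using integral_norm_bound[of M "\<lambda>w. cis (t \<bullet> V w)"] by (simp add: char_fun_def prob_space)

lemma norm_char_fun_eq_gap:
  fixes Y Y' :: "'a \<Rightarrow> 'b :: euclidean_space"
  assumes ind: "indep_var borel Y borel Y'" and dist: "distr M borel Y' = distr M borel Y"
  shows "(norm (char_fun M Y t))\<^sup>2 = 1 - gap M (\<lambda>w. Y w - Y' w) t"
proof -
  have [measurable]: "Y \<in> borel_measurable M" "Y' \<in> borel_measurable M"
    using indep_var_rv1[OF ind] indep_var_rv2[OF ind] by auto
  have "char_fun M Y' t = (\<integral>y. cis (t \<bullet> y) \<partial>distr M borel Y')"
    unfolding char_fun_def by (subst integral_distr) auto
  also have "\<dots> = char_fun M Y t"
    unfolding dist char_fun_def by (subst integral_distr) auto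
  finally have same: "char_fun M Y' t = char_fun M Y t" .
  have "(\<integral>w. cis (t \<bullet> (Y w - Y' w)) \<partial>M) = (\<integral>w. cis (t \<bullet> Y w) * cnj (cis (t \<bullet> Y' w)) \<partial>M)"
    by (simp add: cis_cnj cis_mult inner_diff_right)
  also have "\<dots> = (\<integral>w. cis (t \<bullet> Y w) \<partial>M) * (\<integral>w. cnj (cis (t \<bullet> Y' w)) \<partial>M)"
  proof (rule indep_var_lebesgue_integral)
    have "indep_var borel ((\<lambda>y. cis (t \<bullet> y)) \<circ> Y) borel ((\<lambda>y. cnj (cis (t \<bullet> y))) \<circ> Y')"
      by (rule indep_var_compose[OF ind]) (auto simp: cis_cnj)
    then show "indep_var borel (\<lambda>w. cis (t \<bullet> Y w)) borel (\<lambda>w. cnj (cis (t \<bullet> Y' w)))"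
      by (simp add: comp_def)
  qed (auto intro!: integrable_cis)
  also have "\<dots> = char_fun M Y t * cnj (char_fun M Y t)"
    using same by (simp add: char_fun_def)
  also have "\<dots> = (norm (char_fun M Y t))\<^sup>2" by (rule complex_norm_square[symmetric])
  finally have "Re (\<integral>w. cis (t \<bullet> (Y w - Y' w)) \<partial>M) = (norm (char_fun M Y t))\<^sup>2" by simp
  moreover have "Re (\<integral>w. cis (t \<bullet> (Y w - Y' w)) \<partial>M) = (\<integral>w. cos (t \<bullet> (Y w - Y' w)) \<partial>M)"
    using integrable_cis[of "\<lambda>w. Y w - Y' w" t] by (simp flip: integral_Re)
  moreover have "integrable M (\<lambda>w. cos (t \<bullet> (Y w - Y' w)))"
    by (rule integrable_const_bound[where B = 1]) auto
  ultimately show ?thesis by (simp add: gap_def prob_space)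
qed

text \<open>
  From \<open>1 - x \<le> exp (- x)\<close>; products of characteristic functions then turn into sums of gaps.
\<close>
lemma norm_char_fun_le_exp_gap:
  fixes Y Y' :: "'a \<Rightarrow> 'b :: euclidean_space"
  assumes "indep_var borel Y borel Y'" "distr M borel Y' = distr M borel Y"
  shows "norm (char_fun M Y t) \<le> exp (- gap M (\<lambda>w. Y w - Y' w) t / 2)"
proof -
  have "(norm (char_fun M Y t))\<^sup>2 \<le> exp (- gap M (\<lambda>w. Y w - Y' w) t)"
    unfolding norm_char_fun_eq_gap[OF assms] using exp_ge_add_one_self[of "- gap M (\<lambda>w. Y w - Y' w) t"] by simp
  also have "\<dots> = (exp (- gap M (\<lambda>w. Y w - Y' w) t / 2))\<^sup>2"
    by (simp add: power2_eq_square exp_add[symmetric])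
  finally show ?thesis by (rule power2_le_imp_le) simp
qed

lemma norm_prod_char_fun_le_exp_gap:
  fixes Y Y' :: "'a \<Rightarrow> 'b :: euclidean_space"
  assumes "indep_var borel Y borel Y'" "distr M borel Y' = distr M borel Y"
  shows "norm (\<Prod>j\<in>J. char_fun M Y (s j)) \<le> exp (- (\<Sum>j\<in>J. gap M (\<lambda>w. Y w - Y' w) (s j)) / 2)"
proof (cases "finite J")
  case True
  have "norm (\<Prod>j\<in>J. char_fun M Y (s j)) \<le> (\<Prod>j\<in>J. exp (- gap M (\<lambda>w. Y w - Y' w) (s j) / 2))"
    unfolding prod_norm[symmetric] by (intro prod_mono conjI norm_char_fun_le_exp_gap assms) auto
  also have "\<dots> = exp (\<Sum>j\<in>J. - gap M (\<lambda>w. Y w - Y' w) (s j) / 2)"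
    by (rule exp_sum[OF True, symmetric])
  finally show ?thesis by (simp add: sum_divide_distrib sum_negf)
qed simp

end

section \<open>Gaussian approximation of a weighted product\<close>

text \<open>
  The second-order expansion of a characteristic function, with \<open>1 - x\<close> replaced by \<open>exp (- x)\<close>
  so that products of the approximations are again exponentials.
\<close>
lemma (in prob_space) char_gaussian_approx:
  assumes [measurable]: "random_variable borel X"
    and int: "integrable M X" "integrable M (\<lambda>x. (X x)\<^sup>2)" "expectation X = 0"
    and "\<epsilon> > 0"
  obtains \<delta> where "\<delta> > 0"
    "\<And>t. \<bar>t\<bar> \<le> \<delta> \<Longrightarrow> cmod (char (distr M borel X) t - exp (- (t\<^sup>2 * variance X / 2))) \<le> \<epsilon> * t\<^sup>2"
proof -
  define s where "s = variance X"
  have s: "s \<ge> 0" by (simp add: s_def)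
  let ?T = "\<lambda>r x. min (6 * (X x)\<^sup>2) (\<bar>r\<bar> * \<bar>X x\<bar> ^ 3)"
  have intT: "integrable M (?T r)" for r
    by (rule Bochner_Integration.integrable_bound[of _ "\<lambda>x. 6 * (X x)\<^sup>2"]) (auto simp: int)
  have "(\<lambda>n. expectation (?T (1 / real (Suc n)))) \<longlonglongrightarrow> expectation (\<lambda>x. 0)"
  proof (rule integral_dominated_convergence[where w = "\<lambda>x. 6 * (X x)\<^sup>2"])
    show "AE x in M. (\<lambda>n. ?T (1 / real (Suc n)) x) \<longlonglongrightarrow> 0"
    proof (rule AE_I2)
      fix x
      have "(\<lambda>n. min (6 * (X x)\<^sup>2) (\<bar>1 / real (Suc n)\<bar> * \<bar>X x\<bar> ^ 3)) \<longlonglongrightarrow> min (6 * (X x)\<^sup>2) (\<bar>0\<bar> * \<bar>X x\<bar> ^ 3)"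
        by (intro tendsto_intros LIMSEQ_Suc lim_1_over_n)
      then show "(\<lambda>n. ?T (1 / real (Suc n)) x) \<longlonglongrightarrow> 0" by simp
    qed
  qed (auto simp: int)
  then have "eventually (\<lambda>n. expectation (?T (1 / real (Suc n))) < \<epsilon>) sequentially"
    by (rule order_tendstoD) (use \<open>\<epsilon> > 0\<close> in simp)
  then obtain n where n: "expectation (?T (1 / real (Suc n))) < \<epsilon>"
    by (auto simp: eventually_sequentially)
  define \<delta> where "\<delta> = min (1 / real (Suc n)) (sqrt (\<epsilon> / (s\<^sup>2 + 1)))"
  have "s\<^sup>2 + 1 > 0" by (simp add: add_nonneg_pos)
  show ?thesis
  proof (rule that)
    show "\<delta> > 0" using \<open>\<epsilon> > 0\<close> \<open>s\<^sup>2 + 1 > 0\<close> by (simp add: \<delta>_def)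
    fix t assume t: "\<bar>t\<bar> \<le> \<delta>"
    have "cmod (char (distr M borel X) t - (1 - t\<^sup>2 * s / 2)) \<le> t\<^sup>2 / 6 * expectation (?T t)"
      by (rule char_approx3') (auto simp: int s_def)
    also have "expectation (?T t) \<le> expectation (?T (1 / real (Suc n)))"
      using t by (intro integral_mono intT min.mono mult_right_mono) (auto simp: \<delta>_def)
    also have "\<dots> \<le> \<epsilon>" using n by simp
    finally have 1: "cmod (char (distr M borel X) t - (1 - t\<^sup>2 * s / 2)) \<le> t\<^sup>2 / 6 * \<epsilon>"
      by (simp add: mult_left_mono)
    have e: "\<bar>exp (- y) - (1 - y)\<bar> \<le> y\<^sup>2 / 2" if "y \<ge> 0" for y :: real
    proof -
      have lo: "1 - y \<le> exp (- y)" using exp_ge_add_one_self[of "- y"] by simp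
      have "exp (- y) = 1 / exp y" by (simp add: exp_minus field_simps)
      also have "\<dots> \<le> 1 / (1 + y + y\<^sup>2 / 2)"
        using exp_lower_Taylor_quadratic[OF that] that by (intro divide_left_mono) (auto intro!: mult_pos_pos add_pos_nonneg)
      also have "\<dots> \<le> 1 - y + y\<^sup>2 / 2"
      proof -
        have "(1 - y + y\<^sup>2 / 2) * (1 + y + y\<^sup>2 / 2) = 1 + y ^ 4 / 4"
          by (simp add: algebra_simps power2_eq_square power4_eq_xxxx)
        then have "1 \<le> (1 - y + y\<^sup>2 / 2) * (1 + y + y\<^sup>2 / 2)" by simp
        moreover have "0 < 1 + y + y\<^sup>2 / 2" using that by (intro add_pos_nonneg) auto
        ultimately show ?thesis by (simp add: pos_divide_le_eq)
      qed
      finally show ?thesis using lo by simp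
    qed
    have "t\<^sup>2 \<le> \<epsilon> / (s\<^sup>2 + 1)"
    proof -
      have "\<bar>t\<bar> \<le> sqrt (\<epsilon> / (s\<^sup>2 + 1))" using t by (simp add: \<delta>_def)
      then have "\<bar>t\<bar>\<^sup>2 \<le> (sqrt (\<epsilon> / (s\<^sup>2 + 1)))\<^sup>2" by (intro power_mono) auto
      then show ?thesis using \<open>\<epsilon> > 0\<close> \<open>s\<^sup>2 + 1 > 0\<close> by simp
    qed
    then have t2: "t\<^sup>2 * s\<^sup>2 \<le> \<epsilon>"
      unfolding pos_le_divide_eq[OF \<open>s\<^sup>2 + 1 > 0\<close>] distrib_left mult_1_right
      using zero_le_power2[of t] by linarith
    have "\<bar>exp (- (t\<^sup>2 * s / 2)) - (1 - t\<^sup>2 * s / 2)\<bar> \<le> (t\<^sup>2 * s / 2)\<^sup>2 / 2"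
      using s by (intro e) auto
    also have "\<dots> = t\<^sup>2 * (t\<^sup>2 * s\<^sup>2) / 8" by (simp add: power2_eq_square)
    also have "\<dots> \<le> t\<^sup>2 * \<epsilon> / 8" using t2 by (intro divide_right_mono mult_left_mono) auto
    finally have "cmod (complex_of_real (exp (- (t\<^sup>2 * s / 2)) - (1 - t\<^sup>2 * s / 2))) \<le> t\<^sup>2 * \<epsilon> / 8"
      unfolding norm_of_real .
    from order_trans[OF norm_triangle_ineq4 add_mono[OF 1 this]]
    have "cmod (char (distr M borel X) t - exp (- (t\<^sup>2 * s / 2))) \<le> t\<^sup>2 / 6 * \<epsilon> + t\<^sup>2 * \<epsilon> / 8"
      by simp
    also have "\<dots> \<le> \<epsilon> * t\<^sup>2" using \<open>\<epsilon> > 0\<close> by (simp add: field_simps)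
    finally show "cmod (char (distr M borel X) t - exp (- (t\<^sup>2 * variance X / 2))) \<le> \<epsilon> * t\<^sup>2"
      by (simp add: s_def)
  qed
qed

text \<open>
  Replacing each factor by its Gaussian approximation costs \<open>\<epsilon> * (j n^{-3/2})^2 \<le> \<epsilon> / n\<close>, hence \<open>\<epsilon>\<close> in
  total, since a difference of products of numbers in the unit disc is at most the sum of the
  differences. The product of the approximations has exponent \<open>- s / 2 * (\<Sum>j\<le>n. j^2) / n^3\<close>.
\<close>
lemma tendsto_weighted_prod_gaussian:
  fixes f :: "real \<Rightarrow> complex" and s :: real
  assumes f1: "\<And>t. cmod (f t) \<le> 1" and "s \<ge> 0"
    and approx: "\<And>\<epsilon>. \<epsilon> > 0 \<Longrightarrow> \<exists>\<delta>>0. \<forall>t. \<bar>t\<bar> \<le> \<delta> \<longrightarrow> cmod (f t - exp (- (t\<^sup>2 * s / 2))) \<le> \<epsilon> * t\<^sup>2"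
  shows "(\<lambda>n. \<Prod>j=1..n. f (real j * real n powr (- 3 / 2))) \<longlonglongrightarrow> exp (- s / 6)"
proof -
  let ?s = "\<lambda>n j. real j * real n powr (- 3 / 2)"
  let ?g = "\<lambda>n. \<Prod>j=1..n. complex_of_real (exp (- ((?s n j)\<^sup>2 * s / 2)))"
  have sq: "(\<Sum>j=1..n. (?s n j)\<^sup>2) = (real n + 1) * (2 * real n + 1) / (6 * (real n)\<^sup>2)" if "n > 0" for n
  proof -
    have "(\<Sum>j=1..n. (?s n j)\<^sup>2) = (\<Sum>j=1..n. (real j)\<^sup>2) * (1 / real n ^ 3)"
      unfolding sum_distrib_right using powr_three_halves_square[OF that] by (simp add: power_mult_distrib)
    also have "\<dots> = (real n + 1) * (2 * real n + 1) / (6 * (real n)\<^sup>2)"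
      using that unfolding sum_squares_nat by (simp add: field_simps power2_eq_square power3_eq_cube)
    finally show ?thesis .
  qed
  have g: "?g \<longlonglongrightarrow> exp (- s / 6)"
  proof -
    have "eventually (\<lambda>n. exp (- s / 2 * ((real n + 1) * (2 * real n + 1) / (6 * (real n)\<^sup>2)))
        = exp (- s / 2 * (\<Sum>j=1..n. (?s n j)\<^sup>2))) sequentially"
      using eventually_gt_at_top[of 0] by eventually_elim (simp only: sq)
    moreover have "(\<lambda>n. exp (- s / 2 * ((real n + 1) * (2 * real n + 1) / (6 * (real n)\<^sup>2)))) \<longlonglongrightarrow> exp (- s / 2 * (1 / 3))"
      by (intro tendsto_exp tendsto_mult_left) real_asymp
    ultimately have "(\<lambda>n. exp (- s / 2 * (\<Sum>j=1..n. (?s n j)\<^sup>2))) \<longlonglongrightarrow> exp (- s / 2 * (1 / 3))"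
      by (rule Lim_transform_eventually[rotated])
    then have "(\<lambda>n. complex_of_real (exp (- s / 2 * (\<Sum>j=1..n. (?s n j)\<^sup>2)))) \<longlonglongrightarrow> complex_of_real (exp (- s / 2 * (1 / 3)))"
      by (rule tendsto_of_real)
    moreover have "exp (- s / 2 * (\<Sum>j=1..n. (?s n j)\<^sup>2)) = (\<Prod>j=1..n. exp (- ((?s n j)\<^sup>2 * s / 2)))" for n
      by (subst exp_sum[symmetric]) (auto simp: sum_distrib_left intro!: sum.cong arg_cong[where f = exp])
    ultimately show ?thesis by (simp only: of_real_prod[symmetric]) simp
  qed
  have "(\<lambda>n. (\<Prod>j=1..n. f (?s n j)) - ?g n) \<longlonglongrightarrow> 0"
  proof (rule LIMSEQ_I)
    fix r :: real assume "r > 0"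
    then obtain \<delta> where \<delta>: "\<delta> > 0" "\<And>t. \<bar>t\<bar> \<le> \<delta> \<Longrightarrow> cmod (f t - exp (- (t\<^sup>2 * s / 2))) \<le> r / 2 * t\<^sup>2"
      using approx[of "r / 2"] by auto
    have "(\<lambda>n. real n powr (- 1 / 2)) \<longlonglongrightarrow> 0" by real_asymp
    then have "eventually (\<lambda>n. real n powr (- 1 / 2) < \<delta>) sequentially"
      by (rule order_tendstoD) (use \<delta> in auto)
    with eventually_gt_at_top[of 0]
    have "eventually (\<lambda>n. norm ((\<Prod>j=1..n. f (?s n j)) - ?g n - 0) < r) sequentially"
    proof eventually_elim
      case (elim n)
      have small: "\<bar>?s n j\<bar> \<le> \<delta>" if "j \<in> {1..n}" for j
      proof -
        have "\<bar>?s n j\<bar> \<le> real n * real n powr (- 3 / 2)" using that by (auto intro!: mult_right_mono)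
        also have "\<dots> = real n powr (- 1 / 2)"
          using elim(1) powr_add[of "real n" 1 "- 3 / 2"] by simp
        finally show ?thesis using elim by simp
      qed
      have "norm ((\<Prod>j=1..n. f (?s n j)) - ?g n) \<le> (\<Sum>j=1..n. norm (f (?s n j) - exp (- ((?s n j)\<^sup>2 * s / 2))))"
        using \<open>s \<ge> 0\<close> by (intro norm_prod_diff f1) (auto simp: norm_of_real)
      also have "\<dots> \<le> (\<Sum>j=1..n. r / 2 * (?s n j)\<^sup>2)"
        by (intro sum_mono \<delta>(2) small)
      also have "\<dots> \<le> (\<Sum>j=1..n. r / 2 * (1 / real n))"
      proof (intro sum_mono mult_left_mono)
        fix j assume j: "j \<in> {1..n}"
        have "(?s n j)\<^sup>2 = (real j)\<^sup>2 * (1 / real n ^ 3)"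
          using powr_three_halves_square[OF elim(1)] by (simp add: power_mult_distrib)
        also have "\<dots> \<le> (real n)\<^sup>2 * (1 / real n ^ 3)"
          using j by (intro mult_right_mono power_mono) auto
        also have "\<dots> = 1 / real n" using elim(1) by (simp add: power2_eq_square power3_eq_cube)
        finally show "(?s n j)\<^sup>2 \<le> 1 / real n" .
      qed (use \<open>r > 0\<close> in auto)
      also have "\<dots> = r / 2" using elim(1) by simp
      finally show ?case using \<open>r > 0\<close> by simp
    qed
    then show "\<exists>no. \<forall>n\<ge>no. norm ((\<Prod>j=1..n. f (?s n j)) - ?g n - 0) < r"
      by (simp add: eventually_sequentially)
  qed
  from tendsto_add[OF this g] show ?thesis by (simp only: diff_add_cancel add_0)
qed

section \<open>Fourier inversion on the integer lattice\<close>

lemma cis_sum: "cis (\<Sum>i\<in>I. f i) = (\<Prod>i\<in>I. cis (f i))"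
  by (induction I rule: infinite_finite_induct) (auto simp: cis_mult[symmetric])

definition cube :: "(real ^ 'd) set" where
  "cube = {t. \<forall>i. \<bar>t $ i\<bar> \<le> pi}"

lemma cube_cbox: "(cube :: (real ^ 'd) set) = cbox (\<chi> i. - pi) (\<chi> i. pi)"
  by (auto simp: cube_def mem_box_cart abs_le_iff minus_le_iff)

lemma cube_borel [measurable]: "cube \<in> sets borel"
  by (simp add: cube_cbox)

lemma indicator_cube: "indicator cube t = (\<Prod>i\<in>UNIV. indicator {-pi..pi} (t $ i) :: real)"
  by (auto simp: cube_def indicator_def abs_le_iff minus_le_iff prod_eq_1_iff not_le split: if_splits)

lemma integral_interval_cis:
  assumes "k \<in> \<int>"
  shows "(\<integral>x. indicator {-pi..pi} x *\<^sub>R cis (x * k) \<partial>lborel) = complex_of_real (if k = 0 then 2 * pi else 0)"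
proof (cases "k = 0")
  case False
  have "(\<integral>x. indicator {-pi..pi} x *\<^sub>R cis (x * k) \<partial>lborel)
      = cis (pi * k) / (\<i> * k) - cis (- pi * k) / (\<i> * k)"
  proof (rule integral_FTC_Icc)
    fix x :: real
    have "((\<lambda>x. exp (\<i> * complex_of_real (x * k)) / (\<i> * k)) has_vector_derivative cis (x * k)) (at x within {-pi..pi})"
      using False by (auto intro!: derivative_eq_intros has_vector_derivative_real_field simp: cis_conv_exp field_simps)
    then show "((\<lambda>x. cis (x * k) / (\<i> * k)) has_vector_derivative cis (x * k)) (at x within {-pi..pi})"
      by (simp add: cis_conv_exp)
  qed (auto intro!: continuous_intros)
  also have "cis (- pi * k) = cis (pi * k)"
    using assms by (auto elim!: Ints_cases simp: complex_eq_iff mult.commute)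
  finally show ?thesis using False by simp
qed (simp add: scaleR_conv_of_real)

text \<open>
  Orthogonality of the characters of the torus, which factorises over the coordinates.
\<close>
lemma integral_cube_cis:
  fixes k :: "real ^ 'd"
  assumes "k \<in> int_points"
  shows "(\<integral>t. indicator cube t *\<^sub>R cis (t \<bullet> k) \<partial>lborel) = complex_of_real (if k = 0 then (2 * pi) ^ CARD('d) else 0)"
proof -
  have int: "integrable lborel (\<lambda>x. indicator {-pi..pi} x *\<^sub>R cis (x * (k $ i)))" for i
    by (rule borel_integrable_compact) (auto intro!: continuous_intros)
  have "indicator cube t *\<^sub>R cis (t \<bullet> k) = (\<Prod>i\<in>UNIV. indicator {-pi..pi} (t $ i) *\<^sub>R cis (t $ i * k $ i))" for t
    by (simp add: indicator_cube inner_vec_def cis_sum scaleR_conv_of_real prod.distrib)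
  then have "(\<integral>t. indicator cube t *\<^sub>R cis (t \<bullet> k) \<partial>lborel)
      = (\<integral>t. (\<Prod>i\<in>UNIV. indicator {-pi..pi} (t $ i) *\<^sub>R cis (t $ i * k $ i)) \<partial>(lborel :: (real ^ 'd) measure))"
    by simp
  also have "\<dots> = (\<Prod>i\<in>UNIV. \<integral>x. indicator {-pi..pi} x *\<^sub>R cis (x * k $ i) \<partial>lborel)"
    by (rule integral_lborel_vec_prod) (rule int)
  also have "\<dots> = (\<Prod>i\<in>UNIV. complex_of_real (if k $ i = 0 then 2 * pi else 0))"
    using assms by (intro prod.cong refl integral_interval_cis) (auto simp: int_points_def)
  also have "\<dots> = complex_of_real (if k = 0 then (2 * pi) ^ CARD('d) else 0)"
    by (auto simp: vec_eq_iff)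
  finally show ?thesis .
qed

lemma int_points_add: "x \<in> int_points \<Longrightarrow> y \<in> int_points \<Longrightarrow> x + y \<in> int_points"
  and int_points_diff: "x \<in> int_points \<Longrightarrow> y \<in> int_points \<Longrightarrow> x - y \<in> int_points"
  and int_points_scale: "c \<in> \<int> \<Longrightarrow> x \<in> int_points \<Longrightarrow> c *\<^sub>R x \<in> int_points"
  and int_points_0: "0 \<in> int_points"
  by (auto simp: int_points_def)

lemma int_points_sum: "(\<And>i. i \<in> I \<Longrightarrow> f i \<in> int_points) \<Longrightarrow> (\<Sum>i\<in>I. f i) \<in> int_points"
  by (induction I rule: infinite_finite_induct) (auto simp: int_points_add int_points_0)

text \<open>
  Non-degeneracy of the covariance form is encoded by a matrix \<open>A\<close> that turns it into the squared norm.
  This provides both the ellipticity of the form and the substitution that evaluates the Gaussian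
  integral.
\<close>
locale lattice_walk = prob_space M for M :: "'w measure" +
  fixes Z :: "nat \<Rightarrow> 'w \<Rightarrow> real ^ 'd" and A :: "real ^ 'd ^ 'd"
  assumes indep: "indep_vars (\<lambda>_. borel) Z UNIV"
    and ident: "\<And>i. distr M borel (Z i) = distr M borel (Z 0)"
    and integral_points: "\<And>i. AE w in M. Z i w \<in> int_points"
    and square_integrable: "integrable M (\<lambda>w. (norm (Z 0 w))\<^sup>2)"
    and aperiodic: "\<And>t. t \<in> cube \<Longrightarrow> norm (char_fun M (Z 0) t) = 1 \<Longrightarrow> t = 0"
    and whitening: "\<And>v. expectation (\<lambda>w. ((A *v v) \<bullet> (Z 0 w - expectation (Z 0)))\<^sup>2) = (norm v)\<^sup>2"
    and det_A: "det A \<noteq> 0"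
begin

text \<open>
  Here \<open>Y\<close> is the centred step with characteristic function \<open>\<psi>\<close> and covariance form \<open>Q\<close>. The
  function \<open>J n\<close> is the characteristic function of the centred sum \<open>W n\<close> at \<open>n powr (-3/2) *\<^sub>R u\<close>, cut off
  to the rescaled cube. The weight \<open>n + 1 - j\<close> of \<open>Z j\<close> counts the partial sums that contain it.
\<close>
definition "mean = expectation (Z 0)"
definition "Y j w = Z j w - mean"
definition "\<psi> = char_fun M (Y 0)"
definition "Q u = expectation (\<lambda>w. (u \<bullet> Y 0 w)\<^sup>2)"
definition "W n w = (\<Sum>j=1..n. (real n + 1 - real j) *\<^sub>R Z j w)"
definition "J n u = indicator cube (real n powr (- 3 / 2) *\<^sub>R u) *\<^sub>R (\<Prod>j=1..n. \<psi> ((real j * real n powr (- 3 / 2)) *\<^sub>R u))"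

lemma Z_measurable [measurable]: "Z i \<in> borel_measurable M"
  using indep by (auto simp: indep_vars_def)

lemma Y_measurable [measurable]: "Y i \<in> borel_measurable M"
  unfolding Y_def[abs_def] by measurable

lemma W_measurable [measurable]: "W n \<in> borel_measurable M"
  unfolding W_def[abs_def] by measurable

lemma \<psi>_measurable [measurable]: "\<psi> \<in> borel_measurable borel"
  unfolding \<psi>_def by (rule borel_measurable_continuous_onI[OF continuous_char_fun]) simp

lemma J_measurable [measurable]: "J n \<in> borel_measurable borel"
  unfolding J_def[abs_def] by measurable

lemma Y_ident: "distr M borel (Y i) = distr M borel (Y 0)"
proof -
  have "distr M borel (Y j) = distr (distr M borel (Z j)) borel (\<lambda>z. z - mean)" for j
    by (subst distr_distr) (auto simp: comp_def Y_def[abs_def])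
  then show ?thesis using ident[of i] by simp
qed

lemma Y_indep: "indep_vars (\<lambda>_. borel) Y I"
  using indep_vars_compose2[OF indep_vars_subset[OF indep subset_UNIV], of I "\<lambda>_ z. z - mean" "\<lambda>_. borel"]
  by (simp add: Y_def[abs_def])

text \<open>
  The steps with index 0 and 1 serve as the two independent copies in the symmetrisation.
\<close>
lemma Y_indep_pair: "indep_var borel (Y 0) borel (Y 1)"
proof -
  have "indep_var (PiM {0} (\<lambda>_. borel)) (\<lambda>w. restrict (\<lambda>i. Y i w) {0})
      (PiM {1} (\<lambda>_. borel)) (\<lambda>w. restrict (\<lambda>i. Y i w) {1})"
    by (rule indep_var_restrict[OF Y_indep[of UNIV]]) auto
  from indep_var_compose[OF this, of "\<lambda>f. f 0" borel "\<lambda>f. f 1" borel] show ?thesis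
    by (simp add: comp_def)
qed

lemma Z_integrable: "integrable M (Z 0)"
  by (rule integrable_of_square_norm[OF Z_measurable square_integrable])

lemma Y_integrable: "integrable M (Y 0)"
  unfolding Y_def[abs_def] using Z_integrable by auto

lemma Y_mean_0: "expectation (Y 0) = 0"
  unfolding Y_def[abs_def] mean_def using Z_integrable by (simp add: prob_space)

lemma Y_square_integrable: "integrable M (\<lambda>w. (norm (Y 0 w))\<^sup>2)"
proof (rule Bochner_Integration.integrable_bound)
  show "integrable M (\<lambda>w. 2 * (norm (Z 0 w))\<^sup>2 + 2 * (norm mean)\<^sup>2)"
    using square_integrable by auto
  show "AE w in M. norm ((norm (Y 0 w))\<^sup>2) \<le> norm (2 * (norm (Z 0 w))\<^sup>2 + 2 * (norm mean)\<^sup>2)"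
    by (auto simp: Y_def norm_diff_square_le)
qed simp

lemma inner_Y_square_integrable: "integrable M (\<lambda>w. (u \<bullet> Y 0 w)\<^sup>2)"
proof (rule Bochner_Integration.integrable_bound)
  show "integrable M (\<lambda>w. (norm u)\<^sup>2 * (norm (Y 0 w))\<^sup>2)" using Y_square_integrable by simp
  show "AE w in M. norm ((u \<bullet> Y 0 w)\<^sup>2) \<le> norm ((norm u)\<^sup>2 * (norm (Y 0 w))\<^sup>2)"
    by (auto simp: inner_square_le)
qed simp

lemma integral_Y_transfer:
  fixes f :: "real ^ 'd \<Rightarrow> 'b :: {banach, second_countable_topology}"
  assumes [measurable]: "f \<in> borel_measurable borel"
  shows "expectation (\<lambda>w. f (Y i w)) = expectation (\<lambda>w. f (Y 0 w))"
    and "integrable M (\<lambda>w. f (Y 0 w)) \<Longrightarrow> integrable M (\<lambda>w. f (Y i w))"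
proof -
  have "expectation (\<lambda>w. f (Y i w)) = (\<integral>y. f y \<partial>distr M borel (Y i))" for i
    by (subst integral_distr) auto
  then show "expectation (\<lambda>w. f (Y i w)) = expectation (\<lambda>w. f (Y 0 w))"
    using Y_ident[of i] by simp
  have "integrable M (\<lambda>w. f (Y i w)) = integrable (distr M borel (Y i)) f" for i
    by (subst integrable_distr_eq) auto
  then show "integrable M (\<lambda>w. f (Y 0 w)) \<Longrightarrow> integrable M (\<lambda>w. f (Y i w))"
    using Y_ident[of i] by simp
qed

lemma Q_whitening: "Q (A *v v) = (norm v)\<^sup>2"
  unfolding Q_def Y_def mean_def by (rule whitening)

text \<open>
  If \<open>u = A *v v\<close>, then \<open>norm u\<close> is at most the operator norm of \<open>A\<close> times \<open>norm v\<close>, and \<open>Q u = (norm v)\<^sup>2\<close>.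
\<close>
lemma Q_lower_bound:
  obtains \<kappa> where "\<kappa> > 0" "\<And>u. \<kappa> * (norm u)\<^sup>2 \<le> Q u"
proof -
  obtain K where K: "K > 0" "\<And>v. norm (A *v v) \<le> norm v * K"
    using bounded_linear.pos_bounded[OF matrix_vector_mul_bounded_linear[of A]] by blast
  have "1 / K\<^sup>2 * (norm u)\<^sup>2 \<le> Q u" for u
  proof -
    have "invertible A" using det_A by (simp add: invertible_det_nz)
    then obtain B where "A ** B = mat 1" by (auto simp: invertible_def)
    then have u: "u = A *v (B *v u)" by (simp add: matrix_vector_mul_assoc)
    define v where "v = B *v u"
    have "(norm u)\<^sup>2 \<le> (norm v * K)\<^sup>2"
      using K(2)[of v] u unfolding v_def[symmetric] by (intro power_mono) auto
    moreover have "Q u = (norm v)\<^sup>2" using Q_whitening[of v] u unfolding v_def by simp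
    ultimately show ?thesis using K(1) by (simp add: field_simps)
  qed
  then show ?thesis using K(1) by (intro that[of "1 / K\<^sup>2"]) auto
qed

lemma second_moment_symmetrised: "expectation (\<lambda>w. (t \<bullet> (Y 0 w - Y 1 w))\<^sup>2) = 2 * Q t"
proof -
  have ind: "indep_var borel (\<lambda>w. t \<bullet> Y 0 w) borel (\<lambda>w. t \<bullet> Y 1 w)"
    using indep_var_compose[OF Y_indep_pair, of "\<lambda>y. t \<bullet> y" borel "\<lambda>y. t \<bullet> y" borel] by (simp add: comp_def)
  have int1: "integrable M (\<lambda>w. t \<bullet> Y 0 w)" using Y_integrable by simp
  have int1': "integrable M (\<lambda>w. t \<bullet> Y 1 w)" by (rule integral_Y_transfer(2)[of "\<lambda>y. t \<bullet> y", OF _ int1]) simp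
  have int2': "integrable M (\<lambda>w. (t \<bullet> Y 1 w)\<^sup>2)"
    by (rule integral_Y_transfer(2)[of "\<lambda>y. (t \<bullet> y)\<^sup>2", OF _ inner_Y_square_integrable]) simp
  have "expectation (\<lambda>w. t \<bullet> Y 0 w) = 0" using Y_integrable Y_mean_0 by simp
  then have "expectation (\<lambda>w. (t \<bullet> Y 0 w) * (t \<bullet> Y 1 w)) = 0"
    by (subst indep_var_lebesgue_integral[OF ind int1 int1']) simp
  moreover have "expectation (\<lambda>w. (t \<bullet> Y 1 w)\<^sup>2) = Q t"
    unfolding Q_def by (rule integral_Y_transfer(1)) simp
  moreover have "(t \<bullet> (Y 0 w - Y 1 w))\<^sup>2 = (t \<bullet> Y 0 w)\<^sup>2 + (t \<bullet> Y 1 w)\<^sup>2 - 2 * ((t \<bullet> Y 0 w) * (t \<bullet> Y 1 w))" for w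
    by (simp add: inner_diff_right power2_diff)
  ultimately show ?thesis
    using inner_Y_square_integrable[of t] int2' indep_var_integrable[OF ind int1 int1']
    by (simp add: Q_def)
qed

text \<open>
  By independence the expectation factorises. The weights \<open>n + 1 - j\<close> run through \<open>1..n\<close> in reverse
  order, and the steps are identically distributed, so the product may be indexed by the weights.
\<close>
lemma integral_cis_W:
  "expectation (\<lambda>w. cis (t \<bullet> (W n w - z)))
    = cis (- (t \<bullet> (z - (real n * (real n + 1) / 2) *\<^sub>R mean))) * (\<Prod>j=1..n. \<psi> (real j *\<^sub>R t))"
proof -
  let ?c = "z - (real n * (real n + 1) / 2) *\<^sub>R mean"
  let ?a = "\<lambda>j. real n + 1 - real j"
  have W: "W n w - z = (\<Sum>j=1..n. ?a j *\<^sub>R Y j w) - ?c" for w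
    unfolding W_def Y_def scaleR_diff_right sum_subtractf sum_weights_scaleR by simp
  have "t \<bullet> (W n w - z) = - (t \<bullet> ?c) + (\<Sum>j=1..n. (?a j *\<^sub>R t) \<bullet> Y j w)" for w
    unfolding W inner_diff_right inner_sum_right inner_scaleR_left inner_scaleR_right by simp
  then have "cis (t \<bullet> (W n w - z)) = cis (- (t \<bullet> ?c)) * (\<Prod>j=1..n. cis ((?a j *\<^sub>R t) \<bullet> Y j w))" for w
    by (simp only: cis_sum[symmetric] cis_mult)
  then have "expectation (\<lambda>w. cis (t \<bullet> (W n w - z)))
      = cis (- (t \<bullet> ?c)) * expectation (\<lambda>w. \<Prod>j=1..n. cis ((?a j *\<^sub>R t) \<bullet> Y j w))"
    by simp
  also have "expectation (\<lambda>w. \<Prod>j=1..n. cis ((?a j *\<^sub>R t) \<bullet> Y j w))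
      = (\<Prod>j=1..n. expectation (\<lambda>w. cis ((?a j *\<^sub>R t) \<bullet> Y j w)))"
  proof (rule indep_vars_lebesgue_integral)
    show "indep_vars (\<lambda>_. borel) (\<lambda>j w. cis ((?a j *\<^sub>R t) \<bullet> Y j w)) {1..n}"
      by (rule indep_vars_compose2[OF Y_indep, where Y = "\<lambda>j y. cis ((?a j *\<^sub>R t) \<bullet> y)"]) measurable
  qed (simp_all only: finite_atLeastAtMost integrable_cis Y_measurable)
  also have "\<dots> = (\<Prod>j=1..n. \<psi> (?a j *\<^sub>R t))"
    unfolding \<psi>_def char_fun_def by (intro prod.cong refl integral_Y_transfer(1)) measurable
  also have "\<dots> = (\<Prod>j=1..n. \<psi> (real j *\<^sub>R t))"
    by (rule prod.reindex_bij_witness[of _ "\<lambda>j. n + 1 - j" "\<lambda>j. n + 1 - j"]) (auto simp: of_nat_diff algebra_simps)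
  finally show ?thesis .
qed

lemma W_integral_points: "AE w in M. W n w \<in> int_points"
proof -
  have "AE w in M. \<forall>j\<in>{1..n}. Z j w \<in> int_points"
    by (rule AE_finite_allI) (auto simp: integral_points)
  then show ?thesis
    unfolding W_def by eventually_elim (auto intro!: int_points_sum int_points_scale)
qed

text \<open>
  Integrate \<open>cis (t \<bullet> (W n - z))\<close> over \<open>t\<close> in the cube and over the probability space. In one order the
  cube integral detects the event \<open>W n = z\<close>, because \<open>W n - z\<close> is an integer vector; in the other order the
  expectation is a product of characteristic functions.
\<close>
lemma lattice_inversion:
  assumes "z \<in> int_points"
  shows "complex_of_real ((2 * pi) ^ CARD('d) * prob {w \<in> space M. W n w = z})
    = (\<integral>t. indicator cube t *\<^sub>R (cis (- (t \<bullet> (z - (real n * (real n + 1) / 2) *\<^sub>R mean)))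
          * (\<Prod>j=1..n. \<psi> (real j *\<^sub>R t))) \<partial>lborel)"
proof -
  have times: "emeasure (lborel \<Otimes>\<^sub>M M) ((cube :: (real ^ 'd) set) \<times> space M) = emeasure lborel (cube :: (real ^ 'd) set) * emeasure M (space M)"
    by (rule emeasure_pair_measure_Times) auto
  interpret pair_sigma_finite lborel M by standard
  let ?f = "\<lambda>t w. indicator cube t *\<^sub>R cis (t \<bullet> (W n w - z))"
  have int: "integrable (lborel \<Otimes>\<^sub>M M) (\<lambda>(t, w). ?f t w)"
  proof (rule integrableI_bounded_set[where A = "cube \<times> space M" and B = 1])
    show "emeasure (lborel \<Otimes>\<^sub>M M) ((cube :: (real ^ 'd) set) \<times> space M) < \<infinity>"
      using emeasure_lborel_cbox_finite[of "\<chi> i. - pi" "\<chi> i. pi :: real ^ 'd"]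
      unfolding times by (auto simp: emeasure_space_1 cube_cbox)
    show "AE x in lborel \<Otimes>\<^sub>M M. x \<notin> cube \<times> space M \<longrightarrow> (case x of (t, w) \<Rightarrow> ?f t w) = 0"
      by (auto intro!: AE_I2 simp: space_pair_measure indicator_def split: if_splits)
  qed (auto simp: indicator_def split: prod.splits)
  have "(\<integral>t. indicator cube t *\<^sub>R (cis (- (t \<bullet> (z - (real n * (real n + 1) / 2) *\<^sub>R mean)))
          * (\<Prod>j=1..n. \<psi> (real j *\<^sub>R t))) \<partial>lborel) = (\<integral>t. (\<integral>w. ?f t w \<partial>M) \<partial>lborel)"
    by (simp add: integral_cis_W)
  also have "\<dots> = (\<integral>w. (\<integral>t. ?f t w \<partial>lborel) \<partial>M)"
    by (rule Fubini_integral[OF int, symmetric])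
  also have "\<dots> = (\<integral>w. complex_of_real ((2 * pi) ^ CARD('d) * indicator {w \<in> space M. W n w = z} w) \<partial>M)"
  proof (rule integral_cong_AE)
    show "(\<lambda>w. \<integral>t. ?f t w \<partial>lborel) \<in> borel_measurable M"
      by measurable
    show "AE w in M. (\<integral>t. ?f t w \<partial>lborel) = complex_of_real ((2 * pi) ^ CARD('d) * indicator {w \<in> space M. W n w = z} w)"
      using W_integral_points[of n] AE_space
    proof eventually_elim
      case (elim w)
      then have "W n w - z \<in> int_points" using assms by (intro int_points_diff)
      from integral_cube_cis[OF this] elim show ?case by (auto simp: indicator_def)
    qed
  qed simp
  also have "\<dots> = complex_of_real ((2 * pi) ^ CARD('d) * prob {w \<in> space M. W n w = z})"
    by (simp del: of_real_mult add: integral_complex_of_real)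
  finally show ?thesis by simp
qed

lemma scaled_lattice_inversion:
  assumes "z \<in> int_points" "n > 0"
  defines "y \<equiv> real n powr (- 3 / 2) *\<^sub>R (z - (real n * (real n + 1) / 2) *\<^sub>R mean)"
  shows "complex_of_real ((2 * pi) ^ CARD('d) * (real n powr (3 * real CARD('d) / 2) * prob {w \<in> space M. W n w = z}))
    = (\<integral>u. cis (- (u \<bullet> y)) * J n u \<partial>lborel)"
proof -
  define s where "s = real n powr (- 3 / 2)"
  have s: "s > 0" using \<open>n > 0\<close> by (simp add: s_def)
  let ?c = "z - (real n * (real n + 1) / 2) *\<^sub>R mean"
  let ?f = "\<lambda>t. indicator cube t *\<^sub>R (cis (- (t \<bullet> ?c)) * (\<Prod>j=1..n. \<psi> (real j *\<^sub>R t)))"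
  have "(\<integral>t. ?f t \<partial>lborel) = (\<integral>t. ?f t \<partial>density (distr lborel borel (\<lambda>u. 0 + s *\<^sub>R u)) (\<lambda>_. \<bar>s\<bar> ^ DIM(real ^ 'd)))"
    using s by (subst lborel_affine[of s 0, symmetric]) auto
  also have "\<dots> = s ^ CARD('d) *\<^sub>R (\<integral>u. ?f (s *\<^sub>R u) \<partial>lborel)"
    using s by (subst integral_density) (auto simp: integral_distr simp flip: scaleR_scaleR)
  also have "(\<lambda>u. ?f (s *\<^sub>R u)) = (\<lambda>u. cis (- (u \<bullet> y)) * J n u)"
    by (auto simp: J_def y_def s_def fun_eq_iff mult.commute)
  finally have *: "complex_of_real ((2 * pi) ^ CARD('d) * prob {w \<in> space M. W n w = z})
      = s ^ CARD('d) *\<^sub>R (\<integral>u. cis (- (u \<bullet> y)) * J n u \<partial>lborel)"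
    using lattice_inversion[OF assms(1)] by simp
  have "real n powr (3 * real CARD('d) / 2) * s ^ CARD('d) = 1"
  proof -
    have "s ^ CARD('d) = real n powr (- 3 / 2 * real CARD('d))"
      using powr_realpow[OF s, of "CARD('d)"] by (simp add: s_def powr_powr)
    then show ?thesis using \<open>n > 0\<close> by (simp add: powr_add[symmetric])
  qed
  then have "(\<integral>u. cis (- (u \<bullet> y)) * J n u \<partial>lborel)
      = real n powr (3 * real CARD('d) / 2) *\<^sub>R (s ^ CARD('d) *\<^sub>R (\<integral>u. cis (- (u \<bullet> y)) * J n u \<partial>lborel))"
    by simp
  then show ?thesis unfolding *[symmetric] by (simp add: scaleR_conv_of_real mult_ac)
qed

end

section \<open>Convergence of the Fourier integrand\<close>

lemma integrable_exp_norm_square: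
  assumes "c > 0"
  shows "integrable lborel (\<lambda>u :: real ^ 'd. exp (- c * (norm u)\<^sup>2))"
proof -
  have r: "integrable lborel (\<lambda>x :: real. exp (- c * x\<^sup>2))"
  proof -
    define \<sigma> where "\<sigma> = 1 / sqrt (2 * c)"
    have "\<sigma> > 0" "\<sigma>\<^sup>2 = 1 / (2 * c)" using assms by (auto simp: \<sigma>_def power_divide)
    then have "normal_density 0 \<sigma> x = 1 / sqrt (2 * pi * \<sigma>\<^sup>2) * exp (- c * x\<^sup>2)" for x
      using assms by (simp add: normal_density_def)
    then have "exp (- c * x\<^sup>2) = sqrt (2 * pi * \<sigma>\<^sup>2) * normal_density 0 \<sigma> x" for x
      using \<open>\<sigma> > 0\<close> by simp
    moreover have "integrable lborel (normal_density 0 \<sigma>)"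
      using \<open>\<sigma> > 0\<close> by (rule integrable_normal_density)
    ultimately show ?thesis by simp
  qed
  have "integrable lborel (\<lambda>u :: real ^ 'd. \<Prod>i\<in>UNIV. complex_of_real (exp (- c * (u $ i)\<^sup>2)))"
    by (rule integrable_lborel_vec_prod) (use r in \<open>rule integrable_of_real\<close>)
  then have "integrable lborel (\<lambda>u :: real ^ 'd. norm (\<Prod>i\<in>UNIV. complex_of_real (exp (- c * (u $ i)\<^sup>2))))"
    by (rule integrable_norm)
  moreover have "norm (\<Prod>i\<in>UNIV. complex_of_real (exp (- c * (u $ i)\<^sup>2))) = exp (- c * (norm u)\<^sup>2)" for u :: "real ^ 'd"
    by (simp add: norm_square_vec prod_norm[symmetric] exp_sum[symmetric] sum_distrib_left sum_negf)
  ultimately show ?thesis by simp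
qed

lemma cube_volume: "measure lborel (cube :: (real ^ 'd) set) = (2 * pi) ^ CARD('d)"
proof -
  have "(0 :: real ^ 'd) \<in> cbox (\<chi> i. - pi) (\<chi> i. pi)" by (simp add: mem_box_cart)
  then show ?thesis unfolding cube_cbox by (subst content_cbox_cart) auto
qed

lemma scaled_cube_integral:
  assumes "s > 0"
  shows "integrable lborel (\<lambda>u :: real ^ 'd. indicator cube (s *\<^sub>R u) :: real)"
    and "(\<integral>u. indicator cube (s *\<^sub>R u) \<partial>(lborel :: (real ^ 'd) measure)) = (2 * pi / s) ^ CARD('d)"
proof -
  have fin: "emeasure lborel (cube :: (real ^ 'd) set) < \<infinity>"
    unfolding cube_cbox by (rule emeasure_lborel_cbox_finite)
  have lb: "(lborel :: (real ^ 'd) measure) = density (distr lborel borel (\<lambda>u. s *\<^sub>R u)) (\<lambda>_. ennreal (s ^ CARD('d)))"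
    using lborel_affine[of s "0 :: real ^ 'd"] assms by simp
  have "integrable (lborel :: (real ^ 'd) measure) (indicator cube :: _ \<Rightarrow> real)"
    using fin by (intro integrable_real_indicator) auto
  then show "integrable lborel (\<lambda>u :: real ^ 'd. indicator cube (s *\<^sub>R u) :: real)"
    using assms by (subst (asm) lb, subst (asm) integrable_density) (auto simp: integrable_distr_eq)
  have "(2 * pi) ^ CARD('d) = (\<integral>t. indicator cube t \<partial>(lborel :: (real ^ 'd) measure))"
    using cube_volume[where 'd = 'd] by simp
  also have "\<dots> = s ^ CARD('d) * (\<integral>u. indicator cube (s *\<^sub>R u) \<partial>(lborel :: (real ^ 'd) measure))"
  proof -
    have "(\<integral>t. indicator cube t \<partial>(lborel :: (real ^ 'd) measure))
        = (\<integral>t. s ^ CARD('d) *\<^sub>R indicat_real cube t \<partial>distr lborel borel (\<lambda>u :: real ^ 'd. s *\<^sub>R u))"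
      using assms by (subst lb, subst integral_density) auto
    also have "\<dots> = s ^ CARD('d) * (\<integral>t. indicat_real cube t \<partial>distr lborel borel (\<lambda>u :: real ^ 'd. s *\<^sub>R u))"
      by (subst integral_scaleR_right) simp
    also have "(\<integral>t. indicat_real cube t \<partial>distr lborel borel (\<lambda>u :: real ^ 'd. s *\<^sub>R u))
        = (\<integral>u. indicator cube (s *\<^sub>R u) \<partial>(lborel :: (real ^ 'd) measure))"
      by (rule integral_distr) auto
    finally show ?thesis .
  qed
  finally show "(\<integral>u. indicator cube (s *\<^sub>R u) \<partial>(lborel :: (real ^ 'd) measure)) = (2 * pi / s) ^ CARD('d)"
    using assms by (simp add: power_divide field_simps)
qed

context lattice_walk
begin

definition "G u = complex_of_real (exp (- Q u / 6))"

lemma Q_measurable [measurable]: "Q \<in> borel_measurable borel"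
proof -
  have "(\<lambda>u. \<integral>w. (u \<bullet> Y 0 w)\<^sup>2 \<partial>M) \<in> borel_measurable borel"
    by measurable
  then show ?thesis by (simp add: Q_def[abs_def])
qed

lemma G_measurable [measurable]: "G \<in> borel_measurable borel"
  unfolding G_def[abs_def] by measurable

lemma Q_nonneg: "0 \<le> Q u"
  unfolding Q_def by simp

lemma norm_G_le: 
  assumes "\<kappa> * (norm u)\<^sup>2 \<le> Q u"
  shows "norm (G u) \<le> exp (- (\<kappa> / 6) * (norm u)\<^sup>2)"
  using assms by (simp add: G_def)

lemma G_integrable: "integrable lborel G"
proof -
  obtain \<kappa> where \<kappa>: "\<kappa> > 0" "\<And>u. \<kappa> * (norm u)\<^sup>2 \<le> Q u" using Q_lower_bound by blast
  show ?thesis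
    by (rule Bochner_Integration.integrable_bound[OF integrable_exp_norm_square[of "\<kappa> / 6"]])
       (use \<kappa> norm_G_le[OF \<kappa>(2)] in auto)
qed

lemma char_Y: "char_fun M (Y 0) (s *\<^sub>R u) = char (distr M borel (\<lambda>w. u \<bullet> Y 0 w)) s"
  unfolding char_fun_def char_def by (subst integral_distr) (auto simp: cis_conv_exp mult.commute)

lemma J_pointwise: "(\<lambda>n. \<Prod>j=1..n. \<psi> ((real j * real n powr (- 3 / 2)) *\<^sub>R u)) \<longlonglongrightarrow> G u"
  unfolding G_def \<psi>_def char_Y
proof (rule tendsto_weighted_prod_gaussian)
  let ?X = "\<lambda>w. u \<bullet> Y 0 w"
  have 0: "expectation ?X = 0" using Y_integrable Y_mean_0 by simp
  fix \<epsilon> :: real assume "\<epsilon> > 0"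
  then obtain \<delta> where "\<delta> > 0" "\<And>t. \<bar>t\<bar> \<le> \<delta> \<Longrightarrow> cmod (char (distr M borel ?X) t - exp (- (t\<^sup>2 * variance ?X / 2))) \<le> \<epsilon> * t\<^sup>2"
    using char_gaussian_approx[of ?X \<epsilon>] 0 Y_integrable inner_Y_square_integrable by auto
  then show "\<exists>\<delta>>0. \<forall>t. \<bar>t\<bar> \<le> \<delta> \<longrightarrow> cmod (char (distr M borel ?X) t - exp (- (t\<^sup>2 * Q u / 2))) \<le> \<epsilon> * t\<^sup>2"
    unfolding 0 by (auto simp: Q_def)
next
  fix t
  show "cmod (char (distr M borel (\<lambda>w. u \<bullet> Y 0 w)) t) \<le> 1"
    by (intro real_distribution.cmod_char_le_1 real_distribution_distr) measurable
qed (rule Q_nonneg)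

lemma norm_J_le: "norm (J n u) \<le> indicator cube (real n powr (- 3 / 2) *\<^sub>R u) *
    exp (- (\<Sum>j=1..n. gap M (\<lambda>w. Y 0 w - Y 1 w) ((real j * real n powr (- 3 / 2)) *\<^sub>R u)) / 2)"
  using norm_prod_char_fun_le_exp_gap[OF Y_indep_pair Y_ident, where J = "{1..n}" and s = "\<lambda>j. (real j * real n powr (- 3 / 2)) *\<^sub>R u"]
  by (auto simp: J_def \<psi>_def indicator_def)

lemma J_integrable:
  assumes "n > 0"
  shows "integrable lborel (J n)"
proof (rule Bochner_Integration.integrable_bound)
  have s: "real n powr (- 3 / 2) > 0" using assms by simp
  show "integrable lborel (\<lambda>u :: real ^ 'd. indicator cube (real n powr (- 3 / 2) *\<^sub>R u) :: real)"
    using s by (rule scaled_cube_integral)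
  have "norm (J n u) \<le> indicator cube (real n powr (- 3 / 2) *\<^sub>R u)" for u
  proof -
    have "0 \<le> (\<Sum>j=1..n. gap M (\<lambda>w. Y 0 w - Y 1 w) ((real j * real n powr (- 3 / 2)) *\<^sub>R u))"
      by (intro sum_nonneg gap_nonneg)
    then have "exp (- (\<Sum>j=1..n. gap M (\<lambda>w. Y 0 w - Y 1 w) ((real j * real n powr (- 3 / 2)) *\<^sub>R u)) / 2) \<le> 1"
      by simp
    then show ?thesis
      by (intro order_trans[OF norm_J_le] mult_left_le) auto
  qed
  then show "AE u in lborel. norm (J n u) \<le> norm (indicator cube (real n powr (- 3 / 2) *\<^sub>R u) :: real)"
    by auto
qed simp

text \<open>
  Aperiodicity, transferred to the centred steps: centring multiplies the characteristic function by
  a number of modulus 1.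
\<close>
lemma gap_pos:
  assumes "\<And>i. \<bar>t $ i\<bar> \<le> pi" "t \<noteq> 0"
  shows "0 < gap M (\<lambda>w. Y 0 w - Y 1 w) t"
proof -
  have eq: "(\<lambda>w. Z 0 w - Z 1 w) = (\<lambda>w. Y 0 w - Y 1 w)" by (auto simp: Y_def)
  have "indep_var borel (\<lambda>w. Y 0 w + mean) borel (\<lambda>w. Y 1 w + mean)"
    using indep_var_compose[OF Y_indep_pair, of "\<lambda>y. y + mean" borel "\<lambda>y. y + mean" borel] by (simp add: comp_def)
  then have "indep_var borel (Z 0) borel (Z 1)" by (simp add: Y_def)
  from norm_char_fun_eq_gap[OF this ident, of t]
  have g: "gap M (\<lambda>w. Y 0 w - Y 1 w) t = 1 - (norm (char_fun M (Z 0) t))\<^sup>2" unfolding eq by simp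
  have "norm (char_fun M (Z 0) t) \<noteq> 1" using aperiodic[of t] assms by (auto simp: cube_def)
  moreover have "norm (char_fun M (Z 0) t) \<le> 1" by (rule norm_char_fun_le_1) simp
  ultimately have "norm (char_fun M (Z 0) t) < 1" by simp
  then have "(norm (char_fun M (Z 0) t))\<^sup>2 < 1" by (simp add: power_less_one_iff abs_square_less_1)
  then show ?thesis unfolding g by simp
qed

lemma gap_quadratic:
  obtains c \<delta> where "c > 0" "\<delta> > 0"
    "\<And>t. norm t \<le> \<delta> \<Longrightarrow> c * (norm t)\<^sup>2 \<le> gap M (\<lambda>w. Y 0 w - Y 1 w) t"
proof -
  obtain \<kappa> where \<kappa>: "\<kappa> > 0" "\<And>u. \<kappa> * (norm u)\<^sup>2 \<le> Q u" using Q_lower_bound by blast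
  have "integrable M (\<lambda>w. (norm (Y 0 w - Y 1 w))\<^sup>2)"
  proof (rule Bochner_Integration.integrable_bound)
    have "integrable M (\<lambda>w. (norm (Y 1 w))\<^sup>2)"
      by (rule integral_Y_transfer(2)[of "\<lambda>y. (norm y)\<^sup>2", OF _ Y_square_integrable]) simp
    then show "integrable M (\<lambda>w. 2 * (norm (Y 0 w))\<^sup>2 + 2 * (norm (Y 1 w))\<^sup>2)"
      using Y_square_integrable by auto
    show "AE w in M. norm ((norm (Y 0 w - Y 1 w))\<^sup>2) \<le> norm (2 * (norm (Y 0 w))\<^sup>2 + 2 * (norm (Y 1 w))\<^sup>2)"
      by (auto simp: norm_diff_square_le)
  qed simp
  then show ?thesis
    using gap_quadratic_lower_bound[of "\<lambda>w. Y 0 w - Y 1 w" "2 * \<kappa>"] \<kappa> that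
    unfolding second_moment_symmetrised by auto
qed

text \<open>
  In this regime every argument \<open>j n^{-3/2} u\<close> has norm at most \<open>\<delta>\<close>, so the quadratic bound on the gap
  applies to every factor, and \<open>(\<Sum>j\<le>n. j^2) \<ge> n^3 / 3\<close>.
\<close>
lemma J_near_le:
  assumes c: "c > 0" "\<delta> > 0" "\<And>t. norm t \<le> \<delta> \<Longrightarrow> c * (norm t)\<^sup>2 \<le> gap M (\<lambda>w. Y 0 w - Y 1 w) t"
    and "n > 0" "norm u \<le> \<delta> * sqrt (real n)"
  shows "norm (J n u) \<le> exp (- (c / 6) * (norm u)\<^sup>2)"
proof -
  let ?s = "real n powr (- 3 / 2)"
  have s2: "?s\<^sup>2 = 1 / real n ^ 3" using \<open>n > 0\<close> by (rule powr_three_halves_square)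
  have "c * (norm u)\<^sup>2 / 3 \<le> c * (norm u)\<^sup>2 * (\<Sum>j=1..n. (real j)\<^sup>2 * ?s\<^sup>2)"
  proof -
    have "real n ^ 3 / 3 \<le> (\<Sum>j=1..n. (real j)\<^sup>2)"
      unfolding sum_squares_nat by (simp add: field_simps power2_eq_square power3_eq_cube)
    then have "1 / 3 \<le> (\<Sum>j=1..n. (real j)\<^sup>2 * ?s\<^sup>2)"
      using \<open>n > 0\<close> unfolding sum_distrib_right[symmetric] s2 by (simp add: field_simps)
    from mult_left_mono[OF this, of "c * (norm u)\<^sup>2"] c show ?thesis by simp
  qed
  also have "\<dots> = (\<Sum>j=1..n. c * (norm ((real j * ?s) *\<^sub>R u))\<^sup>2)"
    by (simp add: sum_distrib_left power_mult_distrib mult_ac)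
  also have "\<dots> \<le> (\<Sum>j=1..n. gap M (\<lambda>w. Y 0 w - Y 1 w) ((real j * ?s) *\<^sub>R u))"
  proof (intro sum_mono c(3))
    fix j assume "j \<in> {1..n}"
    then have "norm ((real j * ?s) *\<^sub>R u) \<le> (real n * ?s) * (\<delta> * sqrt (real n))"
      using assms by (auto intro!: mult_mono)
    also have "\<dots> = \<delta> * (real n * ?s * sqrt (real n))" by simp
    also have "real n * ?s * sqrt (real n) = real n powr (1 + (- 3 / 2) + 1 / 2)"
      using \<open>n > 0\<close> unfolding powr_add by (simp add: powr_half_sqrt)
    also have "\<dots> = 1" using \<open>n > 0\<close> by simp
    finally show "norm ((real j * ?s) *\<^sub>R u) \<le> \<delta>" by simp
  qed
  finally have "exp (- (\<Sum>j=1..n. gap M (\<lambda>w. Y 0 w - Y 1 w) ((real j * ?s) *\<^sub>R u)) / 2) \<le> exp (- (c / 6) * (norm u)\<^sup>2)"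
    by simp
  then show ?thesis
    by (intro order_trans[OF norm_J_le]) (auto simp: indicator_def)
qed

text \<open>
  The threshold \<open>norm u > \<delta> * sqrt n\<close> corresponds to \<open>norm t > \<delta> / n\<close> for \<open>t = n^{-3/2} u\<close>, which is the
  hypothesis under which the sum of the gaps is linear in \<open>n\<close>.
\<close>
lemma J_far_le:
  assumes \<eta>: "\<And>n t. 4 \<le> n \<Longrightarrow> (\<And>i. \<bar>t $ i\<bar> \<le> pi) \<Longrightarrow> \<delta> / real n \<le> norm t \<Longrightarrow>
       \<eta> * real n \<le> (\<Sum>j=1..n. gap M (\<lambda>w. Y 0 w - Y 1 w) (real j *\<^sub>R t))"
    and "4 \<le> n" "norm u > \<delta> * sqrt (real n)"
  shows "norm (J n u) \<le> indicator cube (real n powr (- 3 / 2) *\<^sub>R u) * exp (- \<eta> * real n / 2)"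
proof (cases "real n powr (- 3 / 2) *\<^sub>R u \<in> cube")
  case True
  let ?s = "real n powr (- 3 / 2)"
  have "n > 0" using \<open>4 \<le> n\<close> by simp
  have "\<delta> / real n = \<delta> * sqrt (real n) * ?s"
  proof -
    have "sqrt (real n) * ?s = real n powr (1 / 2 + (- 3 / 2))"
      using \<open>n > 0\<close> unfolding powr_add by (simp add: powr_half_sqrt)
    also have "\<dots> = 1 / real n" using \<open>n > 0\<close> by (simp add: powr_minus_divide)
    finally show ?thesis unfolding mult.assoc by simp
  qed
  also have "\<dots> \<le> norm (?s *\<^sub>R u)"
    using mult_right_mono[OF less_imp_le[OF assms(3)], of ?s] by (simp add: mult.commute)
  finally have "\<eta> * real n \<le> (\<Sum>j=1..n. gap M (\<lambda>w. Y 0 w - Y 1 w) (real j *\<^sub>R (?s *\<^sub>R u)))"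
    using \<open>4 \<le> n\<close> True by (intro \<eta>) (auto simp: cube_def)
  then have "exp (- (\<Sum>j=1..n. gap M (\<lambda>w. Y 0 w - Y 1 w) ((real j * ?s) *\<^sub>R u)) / 2) \<le> exp (- \<eta> * real n / 2)"
    by simp
  then show ?thesis using True order_trans[OF norm_J_le[of n u]] by simp
qed (simp add: J_def)

text \<open>
  Near the origin dominated convergence applies. Far from it, the exponential bound beats the volume
  of the rescaled cube, which grows only polynomially in \<open>n\<close>.
\<close>
lemma J_converges: "(\<lambda>n. \<integral>u. norm (J n u - G u) \<partial>lborel) \<longlonglongrightarrow> 0"
proof -
  obtain c \<delta> where c: "c > 0" "\<delta> > 0" "\<And>t. norm t \<le> \<delta> \<Longrightarrow> c * (norm t)\<^sup>2 \<le> gap M (\<lambda>w. Y 0 w - Y 1 w) t"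
    using gap_quadratic by blast
  obtain \<eta> where \<eta>: "\<eta> > 0" "\<And>n t. 4 \<le> n \<Longrightarrow> (\<And>i. \<bar>t $ i\<bar> \<le> pi) \<Longrightarrow> \<delta> / real n \<le> norm t \<Longrightarrow>
       \<eta> * real n \<le> (\<Sum>j=1..n. gap M (\<lambda>w. Y 0 w - Y 1 w) (real j *\<^sub>R t))"
    using sum_gap_lower_bound[of "\<lambda>w. Y 0 w - Y 1 w" \<delta>] gap_pos c(2) by (auto simp: measurable_def)
  obtain \<kappa> where \<kappa>: "\<kappa> > 0" "\<And>u. \<kappa> * (norm u)\<^sup>2 \<le> Q u" using Q_lower_bound by blast
  let ?near = "\<lambda>n. {u :: real ^ 'd. norm u \<le> \<delta> * sqrt (real n)}"
  let ?J1 = "\<lambda>n u. indicat_real (?near n) u *\<^sub>R J n u"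
  let ?J2 = "\<lambda>n u. indicat_real (- ?near n) u *\<^sub>R J n u"
  have near_meas [measurable]: "?near n \<in> sets borel" for n by measurable
  have int1: "integrable lborel (?J1 n)" and int2: "integrable lborel (?J2 n)" if "n > 0" for n
    using J_integrable[OF that] by (auto intro!: integrable_mult_indicator)
  have near: "(\<lambda>n. \<integral>u. norm (?J1 n u - G u) \<partial>lborel) \<longlonglongrightarrow> (\<integral>u. 0 \<partial>(lborel :: (real ^ 'd) measure))"
  proof (rule integral_dominated_convergence[where w = "\<lambda>u. exp (- (c / 6) * (norm u)\<^sup>2) + exp (- (\<kappa> / 6) * (norm u)\<^sup>2)"])
    show "integrable lborel (\<lambda>u :: real ^ 'd. exp (- (c / 6) * (norm u)\<^sup>2) + exp (- (\<kappa> / 6) * (norm u)\<^sup>2))"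
      using c \<kappa> by (intro Bochner_Integration.integrable_add integrable_exp_norm_square) auto
    show "AE u in lborel. norm (norm (?J1 n u - G u)) \<le> exp (- (c / 6) * (norm u)\<^sup>2) + exp (- (\<kappa> / 6) * (norm u)\<^sup>2)" for n
    proof (rule AE_I2)
      fix u :: "real ^ 'd"
      have "norm (?J1 n u) \<le> exp (- (c / 6) * (norm u)\<^sup>2)"
      proof (cases "n > 0 \<and> u \<in> ?near n")
        case True
        then show ?thesis using J_near_le[OF c, of n u] by simp
      next
        case False
        \<comment> \<open>at \<open>n = 0\<close> the near region is the origin alone, where \<open>J 0\<close> and the majorant both equal 1\<close>
        then have "u = 0 \<and> n = 0 \<or> u \<notin> ?near n" by auto
        then show ?thesis by (auto simp: J_def indicator_def)
      qed
      then show "norm (norm (?J1 n u - G u)) \<le> exp (- (c / 6) * (norm u)\<^sup>2) + exp (- (\<kappa> / 6) * (norm u)\<^sup>2)"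
        using norm_triangle_ineq4[of "?J1 n u" "G u"] norm_G_le[OF \<kappa>(2)[of u]] by simp
    qed
    show "AE u in lborel. (\<lambda>n. norm (?J1 n u - G u)) \<longlonglongrightarrow> 0"
    proof (rule AE_I2)
      fix u :: "real ^ 'd"
      have "filterlim (\<lambda>n. \<delta> * sqrt (real n)) at_top sequentially"
        using c(2) by real_asymp
      then have "eventually (\<lambda>n. norm u \<le> \<delta> * sqrt (real n)) sequentially"
        by (simp add: filterlim_at_top)
      moreover have "eventually (\<lambda>n. real n powr (- 3 / 2) *\<^sub>R u \<in> cube) sequentially"
      proof -
        have "(\<lambda>n. real n powr (- 3 / 2)) \<longlonglongrightarrow> 0" by real_asymp
        then have "(\<lambda>n. real n powr (- 3 / 2) * norm u) \<longlonglongrightarrow> 0 * norm u" by (rule tendsto_mult_right)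
        then have "eventually (\<lambda>n. real n powr (- 3 / 2) * norm u < pi) sequentially"
          by (rule order_tendstoD) simp
        then show ?thesis
        proof eventually_elim
          case (elim n)
          have "\<bar>(real n powr (- 3 / 2) *\<^sub>R u) $ i\<bar> \<le> pi" for i
            using component_le_norm_cart[of "real n powr (- 3 / 2) *\<^sub>R u" i] elim by simp
          then show ?case by (simp add: cube_def)
        qed
      qed
      ultimately have "eventually (\<lambda>n. (\<Prod>j=1..n. \<psi> ((real j * real n powr (- 3 / 2)) *\<^sub>R u)) = ?J1 n u) sequentially"
        by eventually_elim (simp add: J_def)
      from Lim_transform_eventually[OF J_pointwise this]
      have "(\<lambda>n. ?J1 n u - G u) \<longlonglongrightarrow> G u - G u" by (intro tendsto_diff tendsto_const)
      then show "(\<lambda>n. norm (?J1 n u - G u)) \<longlonglongrightarrow> 0" unfolding diff_self by (rule tendsto_norm_zero)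
    qed
  qed simp_all
  have far: "(\<lambda>n. \<integral>u. norm (?J2 n u) \<partial>lborel) \<longlonglongrightarrow> 0"
  proof (rule tendsto_sandwich[OF _ _ tendsto_const])
    show "eventually (\<lambda>n. 0 \<le> (\<integral>u. norm (?J2 n u) \<partial>lborel)) sequentially" by simp
    show "eventually (\<lambda>n. (\<integral>u. norm (?J2 n u) \<partial>lborel) \<le> (2 * pi / real n powr (- 3 / 2)) ^ CARD('d) * exp (- \<eta> * real n / 2)) sequentially"
      using eventually_ge_at_top[of 4]
    proof eventually_elim
      case (elim n)
      then have s: "real n powr (- 3 / 2) > 0" by simp
      have "(\<integral>u. norm (?J2 n u) \<partial>lborel) 
          \<le> (\<integral>u. indicator cube (real n powr (- 3 / 2) *\<^sub>R u) * exp (- \<eta> * real n / 2) \<partial>(lborel :: (real ^ 'd) measure))"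
      proof (rule integral_mono)
        show "integrable lborel (\<lambda>u. norm (?J2 n u))" using int2[of n] elim by (intro integrable_norm) auto
        show "integrable lborel (\<lambda>u :: real ^ 'd. indicator cube (real n powr (- 3 / 2) *\<^sub>R u) * exp (- \<eta> * real n / 2))"
          using scaled_cube_integral(1)[OF s] by simp
        fix u show "norm (?J2 n u) \<le> indicator cube (real n powr (- 3 / 2) *\<^sub>R u) * exp (- \<eta> * real n / 2)"
          using J_far_le[OF \<eta>(2) elim, where u = u] by (auto simp: indicator_def)
      qed
      also have "\<dots> = (2 * pi / real n powr (- 3 / 2)) ^ CARD('d) * exp (- \<eta> * real n / 2)"
        using scaled_cube_integral[OF s, where 'd = 'd] by simp
      finally show ?case .
    qed
    show "(\<lambda>n. (2 * pi / real n powr (- 3 / 2)) ^ CARD('d) * exp (- \<eta> * real n / 2)) \<longlonglongrightarrow> 0"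
      using \<eta>(1) by real_asymp
  qed
  show ?thesis
  proof (rule tendsto_sandwich[OF _ _ tendsto_const])
    show "(\<lambda>n. (\<integral>u. norm (?J1 n u - G u) \<partial>lborel) + (\<integral>u. norm (?J2 n u) \<partial>lborel)) \<longlonglongrightarrow> 0"
      using tendsto_add[OF near far] by simp
    show "eventually (\<lambda>n. 0 \<le> (\<integral>u. norm (J n u - G u) \<partial>lborel)) sequentially" by simp
    show "eventually (\<lambda>n. (\<integral>u. norm (J n u - G u) \<partial>lborel)
        \<le> (\<integral>u. norm (?J1 n u - G u) \<partial>lborel) + (\<integral>u. norm (?J2 n u) \<partial>lborel)) sequentially"
      using eventually_gt_at_top[of 0]
    proof eventually_elim
      case (elim n)
      have i1: "integrable lborel (\<lambda>u. norm (?J1 n u - G u))"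
        using int1[OF elim] G_integrable by (intro integrable_norm Bochner_Integration.integrable_diff)
      have i2: "integrable lborel (\<lambda>u. norm (?J2 n u))" using int2[OF elim] by (rule integrable_norm)
      have "(\<integral>u. norm (J n u - G u) \<partial>lborel) \<le> (\<integral>u. norm (?J1 n u - G u) + norm (?J2 n u) \<partial>lborel)"
      proof (rule integral_mono)
        show "integrable lborel (\<lambda>u. norm (J n u - G u))"
          using J_integrable[OF elim] G_integrable by auto
        show "integrable lborel (\<lambda>u. norm (?J1 n u - G u) + norm (?J2 n u))"
          using i1 i2 by (rule Bochner_Integration.integrable_add)
        fix u show "norm (J n u - G u) \<le> norm (?J1 n u - G u) + norm (?J2 n u)"
          using norm_triangle_ineq4[of "J n u" "G u"] by (cases "u \<in> ?near n") (auto simp: add.commute)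
      qed
      also have "\<dots> = (\<integral>u. norm (?J1 n u - G u) \<partial>lborel) + (\<integral>u. norm (?J2 n u) \<partial>lborel)"
        using i1 i2 by (rule Bochner_Integration.integral_add)
      finally show ?case .
    qed
  qed
qed

end

section \<open>Local limit theorem for integer-valued steps\<close>

context lattice_walk
begin

text \<open>
  After the substitution \<open>u = A *v v\<close> the integrand is a product of one-dimensional Gaussians.
\<close>
lemma gaussian_fourier:
  "(\<integral>u. cis (- (u \<bullet> y)) * G u \<partial>lborel)
    = complex_of_real (\<bar>det A\<bar> * (sqrt (6 * pi) ^ CARD('d) * exp (- 3 / 2 * (norm (transpose A *v y))\<^sup>2)))"
proof -
  define w where "w = transpose A *v y"
  have "cis (- ((A *v v) \<bullet> y)) * G (A *v v) = (\<Prod>i\<in>UNIV. cis (- (v $ i * w $ i)) * exp (- ((v $ i)\<^sup>2) / 6))" for v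
  proof -
    have "(A *v v) \<bullet> y = v \<bullet> w"
      unfolding w_def by (metis dot_lmul_matrix transpose_matrix_vector inner_commute)
    moreover have "G (A *v v) = complex_of_real (\<Prod>i\<in>UNIV. exp (- ((v $ i)\<^sup>2) / 6))"
      unfolding G_def Q_whitening norm_square_vec by (simp add: exp_sum[symmetric] sum_negf sum_divide_distrib)
    ultimately show ?thesis
      by (simp add: inner_vec_def cis_sum prod.distrib flip: sum_negf)
  qed
  then have "(\<integral>u. cis (- (u \<bullet> y)) * G u \<partial>lborel)
      = \<bar>det A\<bar> *\<^sub>R (\<integral>v. (\<Prod>i\<in>UNIV. cis (- (v $ i * w $ i)) * exp (- ((v $ i)\<^sup>2) / 6)) \<partial>(lborel :: (real ^ 'd) measure))"
    by (subst integral_lborel_vec_linear[OF _ det_A]) auto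
  also have "(\<integral>v. (\<Prod>i\<in>UNIV. cis (- (v $ i * w $ i)) * exp (- ((v $ i)\<^sup>2) / 6)) \<partial>(lborel :: (real ^ 'd) measure))
      = (\<Prod>i\<in>UNIV. complex_of_real (sqrt (6 * pi) * exp (- 3 / 2 * (w $ i)\<^sup>2)))"
    unfolding integral_gaussian_cis[symmetric]
    by (rule integral_lborel_vec_prod) (rule integrable_gaussian_cis)
  also have "\<dots> = complex_of_real (sqrt (6 * pi) ^ CARD('d) * exp (- 3 / 2 * (norm w)\<^sup>2))"
    unfolding norm_square_vec by (simp add: prod.distrib exp_sum sum_distrib_left flip: sum_negf)
  finally show ?thesis by (simp add: w_def scaleR_conv_of_real)
qed

text \<open>
  The centred Gaussian density with covariance matrix \<open>\<Sigma> / 3\<close>, where \<open>\<Sigma>\<close> is the covariance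
  matrix of a step; compare \<open>gauss_density_whitening\<close>.
\<close>
definition "\<rho> y = \<bar>det A\<bar> * (3 / (2 * pi)) powr (real CARD('d) / 2) * exp (- 3 / 2 * (norm (transpose A *v y))\<^sup>2)"

text \<open>
  The constants match because \<open>sqrt (6 * pi) = 2 * pi * sqrt (3 / (2 * pi))\<close> in each coordinate.
\<close>
lemma gaussian_fourier_normalised:
  "(\<integral>u. cis (- (u \<bullet> y)) * G u \<partial>lborel) = complex_of_real ((2 * pi) ^ CARD('d) * \<rho> y)"
proof -
  have "sqrt (6 * pi) = 2 * pi * sqrt (3 / (2 * pi))"
  proof -
    have "6 * pi = (2 * pi)\<^sup>2 * (3 / (2 * pi))" by (simp add: power2_eq_square)
    then show ?thesis by (metis pi_ge_zero real_sqrt_abs real_sqrt_mult abs_of_nonneg mult_nonneg_nonneg zero_le_numeral)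
  qed
  moreover have "sqrt (3 / (2 * pi)) ^ CARD('d) = (3 / (2 * pi)) powr (real CARD('d) / 2)"
  proof -
    have "sqrt (3 / (2 * pi)) ^ CARD('d) = ((3 / (2 * pi)) powr (1 / 2)) powr real CARD('d)"
      by (simp add: powr_half_sqrt powr_realpow)
    then show ?thesis unfolding powr_powr by simp
  qed
  ultimately have "sqrt (6 * pi) ^ CARD('d) = (2 * pi) ^ CARD('d) * (3 / (2 * pi)) powr (real CARD('d) / 2)"
    by (simp only: power_mult_distrib)
  then show ?thesis unfolding gaussian_fourier \<rho>_def by (simp only: mult_ac)
qed

definition "fourier_error n = (\<integral>u. norm (J n u - G u) \<partial>lborel) / (2 * pi) ^ CARD('d)"

lemma fourier_error_tendsto_0: "fourier_error \<longlonglongrightarrow> 0"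
  unfolding fourier_error_def[abs_def] using tendsto_divide[OF J_converges tendsto_const, of "(2 * pi) ^ CARD('d)"] by simp

text \<open>
  Both terms are Fourier integrals against the same character \<open>cis (-(u \<bullet> y))\<close>, whose modulus is 1. The
  bound by the \<open>L^1\<close> distance of \<open>J n\<close> and \<open>G\<close> therefore does not depend on \<open>z\<close>.
\<close>
lemma local_limit:
  assumes "z \<in> int_points" "n > 0"
  shows "\<bar>real n powr (3 * real CARD('d) / 2) * prob {w \<in> space M. W n w = z}
      - \<rho> (real n powr (- 3 / 2) *\<^sub>R (z - (real n * (real n + 1) / 2) *\<^sub>R mean))\<bar> \<le> fourier_error n"
proof -
  define y where "y = real n powr (- 3 / 2) *\<^sub>R (z - (real n * (real n + 1) / 2) *\<^sub>R mean)"
  define p where "p = real n powr (3 * real CARD('d) / 2) * prob {w \<in> space M. W n w = z}"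
  have i: "integrable lborel (\<lambda>u. cis (- (u \<bullet> y)) * f u)"
    if "integrable lborel f" for f :: "real ^ 'd \<Rightarrow> complex"
  proof (rule Bochner_Integration.integrable_bound[OF that])
    show "(\<lambda>u. cis (- (u \<bullet> y)) * f u) \<in> borel_measurable lborel"
      using borel_measurable_integrable[OF that] by measurable
  qed (simp add: norm_mult)
  have "complex_of_real ((2 * pi) ^ CARD('d) * (p - \<rho> y))
      = (\<integral>u. cis (- (u \<bullet> y)) * J n u \<partial>lborel) - (\<integral>u. cis (- (u \<bullet> y)) * G u \<partial>lborel)"
    using scaled_lattice_inversion[OF assms] unfolding gaussian_fourier_normalised
    by (simp add: p_def y_def right_diff_distrib)
  also have "\<dots> = (\<integral>u. cis (- (u \<bullet> y)) * (J n u - G u) \<partial>lborel)"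
    using i[OF J_integrable[OF assms(2)]] i[OF G_integrable] by (simp add: right_diff_distrib)
  finally have diff: "complex_of_real ((2 * pi) ^ CARD('d) * (p - \<rho> y))
      = (\<integral>u. cis (- (u \<bullet> y)) * (J n u - G u) \<partial>lborel)" .
  have "norm (complex_of_real ((2 * pi) ^ CARD('d) * (p - \<rho> y)))
      \<le> (\<integral>u. norm (cis (- (u \<bullet> y)) * (J n u - G u)) \<partial>lborel)"
    unfolding diff by (rule integral_norm_bound)
  then have "(2 * pi) ^ CARD('d) * \<bar>p - \<rho> y\<bar> \<le> (\<integral>u. norm (J n u - G u) \<partial>lborel)"
    unfolding norm_of_real by (simp add: norm_mult abs_mult)
  then show ?thesis
    unfolding fourier_error_def p_def[symmetric] y_def[symmetric] by (simp add: pos_le_divide_eq mult.commute)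
qed

end

section \<open>The minimal subgroup and aperiodicity\<close>

lemma int_points_borel [measurable]: "(int_points :: (real ^ 'd) set) \<in> sets borel"
proof -
  have "int_points = (\<Inter>i. (\<lambda>z :: real ^ 'd. z $ i) -` \<int>)" by (auto simp: int_points_def)
  moreover have "closed ((\<lambda>z :: real ^ 'd. z $ i) -` \<int>)" for i
    by (intro continuous_closed_vimage closed_Ints continuous_intros)
  ultimately have "closed (int_points :: (real ^ 'd) set)" using closed_INT[of UNIV "\<lambda>i. (\<lambda>z :: real ^ 'd. z $ i) -` \<int>"] by simp
  then show ?thesis by (rule borel_closed)
qed

text \<open>
  This is the equality case of the triangle inequality: if the characteristic function equals
  \<open>cis \<alpha>\<close>, then \<open>1 - cos (t \<bullet> V - \<alpha>)\<close> is nonnegative with expectation 0.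
\<close>
lemma (in prob_space) norm_char_fun_eq_1_imp_coset:
  fixes V :: "'a \<Rightarrow> 'b :: euclidean_space"
  assumes [measurable]: "V \<in> borel_measurable M" and "norm (char_fun M V t) = 1"
  obtains \<alpha> where "AE w in M. (t \<bullet> V w - \<alpha>) / (2 * pi) \<in> \<int>"
proof -
  define \<alpha> where "\<alpha> = Arg (char_fun M V t)"
  have "char_fun M V t = cis \<alpha>"
    using assms(2) by (metis \<alpha>_def norm_zero rcis_cmod_Arg rcis_def mult_1 of_real_1)
  then have "1 = Re (cis (- \<alpha>) * char_fun M V t)" by (simp add: cis_mult)
  also have "\<dots> = (\<integral>w. Re (cis (- \<alpha>) * cis (t \<bullet> V w)) \<partial>M)"
    unfolding char_fun_def using integrable_cis[of V t] by (subst integral_Re) auto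
  also have "\<dots> = (\<integral>w. cos (t \<bullet> V w - \<alpha>) \<partial>M)" by (simp only: cis_mult) simp
  finally have 1: "(\<integral>w. cos (t \<bullet> V w - \<alpha>) \<partial>M) = 1" by simp
  have int: "integrable M (\<lambda>w. cos (t \<bullet> V w - \<alpha>))"
    by (rule integrable_const_bound[where B = 1]) auto
  then have int': "integrable M (\<lambda>w. 1 - cos (t \<bullet> V w - \<alpha>))" by simp
  have "(\<integral>w. 1 - cos (t \<bullet> V w - \<alpha>) \<partial>M) = 0" using int 1 by (simp add: prob_space)
  then have "AE w in M. 1 - cos (t \<bullet> V w - \<alpha>) = 0"
    using integral_nonneg_eq_0_iff_AE[OF int'] by simp
  then have "AE w in M. (t \<bullet> V w - \<alpha>) / (2 * pi) \<in> \<int>"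
  proof eventually_elim
    case (elim w)
    then have "cos (t \<bullet> V w - \<alpha>) = 1" by simp
    then obtain k :: int where "t \<bullet> V w - \<alpha> = of_int k * 2 * pi" by (auto simp: cos_one_2pi_int)
    then show ?case by simp
  qed
  then show ?thesis by (rule that)
qed

text \<open>
  If the modulus is 1 at \<open>t\<close>, then \<open>X\<close> lies in a coset of the closed subgroup \<open>L\<close> of all \<open>y\<close> with
  \<open>t \<bullet> (K *v y)\<close> in \<open>2 * pi * \<int>\<close>. By minimality \<open>L\<close> contains the columns of \<open>H\<close>, which forces each \<open>t $ i\<close>
  to be a multiple of \<open>2 * pi\<close>; in the cube this leaves only 0.
\<close>
lemma minimal_subgroup_aperiodic:
  fixes X :: "'w \<Rightarrow> real ^ 'd" and H K :: "real ^ 'd ^ 'd"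
  assumes "prob_space P" and [measurable]: "X \<in> borel_measurable P"
    and min: "minimal_subgroup P X H" and KH: "K ** H = mat 1"
    and t: "t \<in> cube" "norm (char_fun P (\<lambda>w. K *v (X w - b)) t) = 1"
  shows "t = 0"
proof (rule ccontr)
  assume "t \<noteq> 0"
  interpret prob_space P by fact
  obtain \<alpha> where \<alpha>: "AE w in P. (t \<bullet> (K *v (X w - b)) - \<alpha>) / (2 * pi) \<in> \<int>"
    using norm_char_fun_eq_1_imp_coset[OF _ t(2)] by auto
  define L where "L = {y. (t \<bullet> (K *v y)) / (2 * pi) \<in> \<int>}"
  \<comment> \<open>the base point is chosen so that \<open>t \<bullet> (K *v (x - b)) = \<alpha>\<close>\<close>
  define x where "x = b + H *v ((\<alpha> / (t \<bullet> t)) *\<^sub>R t)"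
  have cont: "continuous_on UNIV (\<lambda>y. (t \<bullet> (K *v y)) / (2 * pi))"
    by (intro continuous_intros matrix_vector_mult_linear_continuous_on) auto
  have "closed ((\<lambda>y. (t \<bullet> (K *v y)) / (2 * pi)) -` \<int>)"
    using cont by (intro continuous_closed_vimage closed_Ints) (simp add: continuous_on_eq_continuous_at)
  then have closed: "closed L" by (simp add: L_def vimage_def)
  then have L: "closed_subgroup L"
    unfolding closed_subgroup_def
    by (auto simp: L_def matrix_vector_right_distrib inner_add_right add_divide_distrib linear_neg[OF matrix_vector_mul_linear])
  have "t \<bullet> (K *v (y - x)) = t \<bullet> (K *v (y - b)) - \<alpha>" for y
  proof -
    have "K *v (y - x) = K *v (y - b) - K *v (H *v ((\<alpha> / (t \<bullet> t)) *\<^sub>R t))"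
      by (simp add: x_def matrix_vector_mult_diff_distrib matrix_vector_right_distrib algebra_simps)
    also have "K *v (H *v ((\<alpha> / (t \<bullet> t)) *\<^sub>R t)) = (\<alpha> / (t \<bullet> t)) *\<^sub>R t"
      by (simp add: matrix_vector_mul_assoc KH)
    finally show ?thesis using \<open>t \<noteq> 0\<close> by (simp add: inner_diff_right)
  qed
  moreover have "X w \<in> (+) x ` L \<longleftrightarrow> X w - x \<in> L" for w
    by (auto simp: image_iff algebra_simps) (metis add.commute diff_add_cancel)
  ultimately have mem: "X w \<in> (+) x ` L \<longleftrightarrow> (t \<bullet> (K *v (X w - b)) - \<alpha>) / (2 * pi) \<in> \<int>" for w
    by (simp add: L_def)
  have "coset_prob P X x L = 1"
    unfolding coset_prob_def
  proof (subst prob_eq_1)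
    have [measurable]: "L \<in> sets borel" using closed by (rule borel_closed)
    have "{w \<in> space P. X w - x \<in> L} \<in> sets P" by measurable
    then show "{w \<in> space P. X w \<in> (+) x ` L} \<in> events"
      by (simp add: \<open>\<And>w. X w \<in> (+) x ` L \<longleftrightarrow> X w - x \<in> L\<close>)
    show "AE w in P. w \<in> {w \<in> space P. X w \<in> (+) x ` L}"
      using \<alpha> AE_space by eventually_elim (simp add: mem)
  qed
  then have sub: "lattice_of H \<subseteq> L" using min L unfolding minimal_subgroup_def by blast
  have "t $ i = 0" for i
  proof -
    have "axis i 1 \<in> int_points" by (auto simp: int_points_def axis_def)
    then have "H *v axis i 1 \<in> L" using sub by (auto simp: lattice_of_def)
    then have "t $ i / (2 * pi) \<in> \<int>"
      by (simp add: L_def matrix_vector_mul_assoc KH inner_axis)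
    then obtain k :: int where k: "t $ i / (2 * pi) = of_int k" by (auto elim: Ints_cases)
    have "\<bar>t $ i / (2 * pi)\<bar> < 1" using t(1) by (auto simp: cube_def abs_divide intro: le_less_trans[of _ pi])
    then have "k = 0" unfolding k by linarith
    then show ?thesis using k by simp
  qed
  then show False using \<open>t \<noteq> 0\<close> by (simp add: vec_eq_iff)
qed

section \<open>The centre of mass of a lattice random walk\<close>

text \<open>
  Exchange of the order of summation: \<open>X j\<close> occurs in the partial sums with index \<open>j, \<dots>, n\<close>.
\<close>
lemma sum_walk: "(\<Sum>i=1..n. walk X i w) = (\<Sum>j=1..n. (real n + 1 - real j) *\<^sub>R X j w)"
proof (induction n)
  case (Suc n)
  have "(\<Sum>i=1..Suc n. walk X i w) = (\<Sum>j=1..n. (real n + 1 - real j) *\<^sub>R X j w) + (\<Sum>j=1..n. X j w) + X (Suc n) w"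
    using Suc by (simp add: walk_def)
  also have "\<dots> = (\<Sum>j=1..n. (real n + 1 - real j) *\<^sub>R X j w + X j w) + X (Suc n) w"
    by (simp only: sum.distrib)
  also have "(\<Sum>j=1..n. (real n + 1 - real j) *\<^sub>R X j w + X j w) = (\<Sum>j=1..n. (real (Suc n) + 1 - real j) *\<^sub>R X j w)"
  proof (intro sum.cong refl)
    fix j
    have "real (Suc n) + 1 - real j = (real n + 1 - real j) + 1" by simp
    then show "(real n + 1 - real j) *\<^sub>R X j w + X j w = (real (Suc n) + 1 - real j) *\<^sub>R X j w"
      by (simp only: scaleR_left_distrib scaleR_one)
  qed
  finally show ?case by simp
qed simp

theorem theorem1p3:
  fixes P :: "'w measure"
    and X :: "nat \<Rightarrow> 'w \<Rightarrow> real ^ 'd"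
    and H M :: "real ^ 'd ^ 'd"
    and b \<mu> :: "real ^ 'd"
    and h :: real
  assumes "prob_space P"
    and "prob_space.indep_vars P (\<lambda>_. borel) X UNIV"
    and "\<And>i. distr P borel (X i) = distr P borel (X 0)"
    and "integrable P (\<lambda>w. (norm (X 0 w))\<^sup>2)"
    and "\<mu> = integral\<^sup>L P (X 0)"
    and "M = cov_matrix P (X 0)"
    and "positive_definite M"
    and "h = \<bar>det H\<bar>"
    and "h > 0"
    and "minimal_subgroup P (X 0) H"
    and "coset_prob P (X 0) b (lattice_of H) = 1"
  shows "(\<lambda>n. SUP x \<in> scaled_lattice H b n.
            ereal \<bar>real n powr (3 * real CARD('d) / 2) / h * com_pmf P X n x
                   - gauss_density M (x - ((real n + 1) / (2 * real n powr (1 / 2))) *\<^sub>R \<mu>)\<bar>)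
         \<longlonglongrightarrow> 0"
proof -
  interpret prob_space P by fact
  have X_meas [measurable]: "X i \<in> borel_measurable P" for i
    using assms(2) by (auto simp: indep_vars_def)
  obtain B :: "real ^ 'd ^ 'd" where B: "transpose B ** M ** B = mat 1"
    using positive_definite_imp_whitening[OF assms(7)] by blast
  have "invertible H" using assms(8,9) by (simp add: invertible_det_nz)
  then obtain K where HK: "H ** K = mat 1" and KH: "K ** H = mat 1" by (auto simp: invertible_def)
  define Z where "Z j w = K *v (X j w - b)" for j w
  \<comment> \<open>the form \<open>v \<bullet> (M *v v)\<close> becomes that of \<open>Z 0\<close> after composition with the inverse transpose of \<open>H\<close>\<close>
  define A where "A = transpose H ** B"
  have Z_int: "Z 0 w \<in> int_points \<longleftrightarrow> X 0 w \<in> (+) b ` lattice_of H" for w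
  proof
    assume "Z 0 w \<in> int_points"
    moreover have "X 0 w = b + H *v Z 0 w" by (simp add: Z_def matrix_vector_mul_assoc HK)
    ultimately show "X 0 w \<in> (+) b ` lattice_of H" by (auto simp: lattice_of_def)
  qed (auto simp: Z_def lattice_of_def matrix_vector_mul_assoc KH)
  have Z_meas [measurable]: "Z i \<in> borel_measurable P" for i
    unfolding Z_def[abs_def] by measurable
  have Z_ident: "distr P borel (Z i) = distr P borel (Z 0)" for i
  proof -
    have "distr P borel (Z j) = distr (distr P borel (X j)) borel (\<lambda>x. K *v (x - b))" for j
      by (subst distr_distr) (auto simp: comp_def Z_def[abs_def])
    then show ?thesis using assms(3)[of i] by simp
  qed
  have X_int: "integrable P (X 0)"
    by (rule integrable_of_square_norm[OF X_meas assms(4)])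
  have Z_mean: "expectation (Z 0) = K *v (\<mu> - b)"
    unfolding Z_def[abs_def] assms(5)
    using X_int by (subst integral_bounded_linear[OF matrix_vector_mul_bounded_linear]) (auto simp: prob_space)
  have B_det: "det B \<noteq> 0" using whitening_det[OF B] by auto
  interpret lattice_walk P Z A
  proof
    show "indep_vars (\<lambda>_. borel) Z UNIV"
      unfolding Z_def[abs_def]
      by (rule indep_vars_compose2[OF assms(2), where Y = "\<lambda>_ x. K *v (x - b)"]) measurable
    show "distr P borel (Z i) = distr P borel (Z 0)" for i by (rule Z_ident)
    have "prob {w \<in> space P. Z 0 w \<in> int_points} = 1"
      using assms(11) by (simp add: Z_int coset_prob_def)
    then have "AE w in P. w \<in> {w \<in> space P. Z 0 w \<in> int_points}"
      by (subst (asm) prob_eq_1) auto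
    then have "AE w in P. Z 0 w \<in> int_points" by eventually_elim simp
    then have AE0: "AE z in distr P borel (Z 0). z \<in> int_points" by (subst AE_distr_iff) auto
    have "AE z in distr P borel (Z i). z \<in> int_points" for i unfolding Z_ident[of i] by (rule AE0)
    then show "AE w in P. Z i w \<in> int_points" for i
      using AE_distr_iff[of "Z i" P borel "\<lambda>z. z \<in> int_points"] by auto
    obtain C where C: "C > 0" "\<And>v. norm (K *v v) \<le> norm v * C"
      using bounded_linear.pos_bounded[OF matrix_vector_mul_bounded_linear[of K]] by blast
    show "integrable P (\<lambda>w. (norm (Z 0 w))\<^sup>2)"
    proof (rule Bochner_Integration.integrable_bound)
      show "integrable P (\<lambda>w. C\<^sup>2 * (2 * (norm (X 0 w))\<^sup>2 + 2 * (norm b)\<^sup>2))"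
        using assms(4) by auto
      have "(norm (Z 0 w))\<^sup>2 \<le> C\<^sup>2 * (2 * (norm (X 0 w))\<^sup>2 + 2 * (norm b)\<^sup>2)" for w
      proof -
        have "(norm (Z 0 w))\<^sup>2 \<le> (norm (X 0 w - b) * C)\<^sup>2"
          unfolding Z_def by (intro power_mono C) auto
        also have "\<dots> = C\<^sup>2 * (norm (X 0 w - b))\<^sup>2" by (simp add: power_mult_distrib)
        also have "\<dots> \<le> C\<^sup>2 * (2 * (norm (X 0 w))\<^sup>2 + 2 * (norm b)\<^sup>2)"
          by (intro mult_left_mono norm_diff_square_le) auto
        finally show ?thesis .
      qed
      then show "AE w in P. norm ((norm (Z 0 w))\<^sup>2) \<le> norm (C\<^sup>2 * (2 * (norm (X 0 w))\<^sup>2 + 2 * (norm b)\<^sup>2))"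
        by auto
    qed simp
    show "t = 0" if "t \<in> cube" "norm (char_fun P (Z 0) t) = 1" for t
      using minimal_subgroup_aperiodic[OF assms(1) X_meas assms(10) KH that(1)] that(2)
      unfolding Z_def[abs_def] by blast
    show "expectation (\<lambda>w. ((A *v v) \<bullet> (Z 0 w - expectation (Z 0)))\<^sup>2) = (norm v)\<^sup>2" for v
    proof -
      have "(A *v v) \<bullet> (Z 0 w - expectation (Z 0)) = (B *v v) \<bullet> (X 0 w - \<mu>)" for w
      proof -
        have "Z 0 w - expectation (Z 0) = K *v (X 0 w - \<mu>)"
          unfolding Z_mean by (simp add: Z_def matrix_vector_mult_diff_distrib)
        then have "(A *v v) \<bullet> (Z 0 w - expectation (Z 0)) = (transpose H *v (B *v v)) \<bullet> (K *v (X 0 w - \<mu>))"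
          by (simp add: A_def matrix_vector_mul_assoc)
        also have "\<dots> = (B *v v) \<bullet> (H *v (K *v (X 0 w - \<mu>)))"
          by (metis dot_lmul_matrix transpose_matrix_vector)
        finally show ?thesis by (simp add: matrix_vector_mul_assoc HK)
      qed
      then have "expectation (\<lambda>w. ((A *v v) \<bullet> (Z 0 w - expectation (Z 0)))\<^sup>2) = (B *v v) \<bullet> (M *v (B *v v))"
        unfolding assms(6) assms(5) using cov_matrix_form[OF assms(1) X_meas assms(4)] by simp
      then show ?thesis by (simp add: whitening_form[OF B])
    qed
    show "det A \<noteq> 0" using B_det assms(8,9) by (simp add: A_def det_mul)
  qed
  have mean: "mean = K *v (\<mu> - b)" by (simp add: mean_def Z_mean)
  have density: "gauss_density M (H *v y) = \<rho> y / h" for y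
  proof -
    have By: "transpose B *v (H *v y) = transpose A *v y"
      unfolding A_def matrix_transpose_mul transpose_transpose matrix_vector_mul_assoc ..
    have "\<bar>det A\<bar> = h * \<bar>det B\<bar>"
      by (simp add: A_def det_mul abs_mult assms(8))
    then show ?thesis
      unfolding gauss_density_whitening[OF B] \<rho>_def By using assms(9) by simp
  qed
  have bound: "\<bar>real n powr (3 * real CARD('d) / 2) / h * com_pmf P X n x
        - gauss_density M (x - ((real n + 1) / (2 * real n powr (1 / 2))) *\<^sub>R \<mu>)\<bar> \<le> fourier_error n / h"
    if n: "n > 0" and x_in: "x \<in> scaled_lattice H b n" for n x
  proof -
    let ?s = "real n powr (- 3 / 2)" and ?k = "real n * (real n + 1) / 2"
    obtain z where z: "z \<in> int_points" and x: "x = ?s *\<^sub>R (?k *\<^sub>R b + H *v z)"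
      using x_in by (auto simp: scaled_lattice_def)
    have s0: "?s \<noteq> 0" using n by simp
    have s1: "real n powr (- 1 / 2) * (1 / real n) = ?s"
    proof -
      have "real n powr (- 1 / 2) * (1 / real n) = real n powr (- 1 / 2) * real n powr (- 1)"
        using n by (simp add: powr_minus_divide)
      then show ?thesis unfolding powr_add[symmetric] by simp
    qed
    have s2: "(real n + 1) / (2 * real n powr (1 / 2)) = ?s * ?k"
    proof -
      have "?s * real n = real n powr (- 3 / 2 + 1)" using n unfolding powr_add by simp
      also have "\<dots> = 1 / real n powr (1 / 2)" by (simp add: powr_minus_divide[symmetric])
      finally have e: "?s * real n = 1 / real n powr (1 / 2)" .
      have "?s * ?k = (?s * real n) * ((real n + 1) / 2)"
        by (simp only: mult.assoc times_divide_eq_right)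
      then show ?thesis unfolding e times_divide_times_eq by (simp only: mult_1 mult.commute[of 2])
    qed
    have W: "?k *\<^sub>R b + H *v W n w = (\<Sum>i=1..n. walk X i w)" for w
    proof -
      have "H *v W n w = (\<Sum>j=1..n. (real n + 1 - real j) *\<^sub>R (X j w - b))"
        unfolding W_def Z_def linear_sum[OF matrix_vector_mul_linear] matrix_vector_mult_scaleR matrix_vector_mul_assoc HK
        by simp
      also have "\<dots> = (\<Sum>j=1..n. (real n + 1 - real j) *\<^sub>R X j w) - ?k *\<^sub>R b"
        unfolding scaleR_diff_right sum_subtractf sum_weights_scaleR ..
      finally show ?thesis unfolding sum_walk by simp
    qed
    have inj: "H *v u = H *v v \<longleftrightarrow> u = v" for u v
      by (metis KH matrix_vector_mul_assoc matrix_vector_mul_lid)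
    have "(real n powr (- 1 / 2)) *\<^sub>R centre_of_mass X n w = x \<longleftrightarrow> W n w = z" for w
    proof -
      have "(real n powr (- 1 / 2)) *\<^sub>R centre_of_mass X n w = ?s *\<^sub>R (?k *\<^sub>R b + H *v W n w)"
        unfolding centre_of_mass_def W scaleR_scaleR s1 ..
      then show ?thesis unfolding x using s0 by (simp add: inj)
    qed
    then have p: "com_pmf P X n x = prob {w \<in> space P. W n w = z}"
      by (simp add: com_pmf_def)
    define y where "y = ?s *\<^sub>R (z - ?k *\<^sub>R mean)"
    have "x - ((real n + 1) / (2 * real n powr (1 / 2))) *\<^sub>R \<mu> = H *v y"
    proof -
      have "H *v y = ?s *\<^sub>R (H *v z - ?k *\<^sub>R (\<mu> - b))"
        unfolding y_def mean by (simp add: matrix_vector_mult_scaleR matrix_vector_mult_diff_distrib[of H] matrix_vector_mul_assoc HK)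
      then show ?thesis unfolding x s2 by (simp add: algebra_simps)
    qed
    then have "\<bar>real n powr (3 * real CARD('d) / 2) / h * com_pmf P X n x
        - gauss_density M (x - ((real n + 1) / (2 * real n powr (1 / 2))) *\<^sub>R \<mu>)\<bar>
      = \<bar>real n powr (3 * real CARD('d) / 2) * prob {w \<in> space P. W n w = z} - \<rho> y\<bar> / h"
      using assms(9) by (simp add: p density diff_divide_distrib[symmetric] abs_divide)
    also have "\<dots> \<le> fourier_error n / h"
      unfolding y_def using local_limit[OF z n] assms(9) by (intro divide_right_mono) auto
    finally show ?thesis .
  qed
  show ?thesis
  proof (rule tendsto_sandwich)
    show "eventually (\<lambda>n. 0 \<le> (SUP x \<in> scaled_lattice H b n.
            ereal \<bar>real n powr (3 * real CARD('d) / 2) / h * com_pmf P X n x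
                   - gauss_density M (x - ((real n + 1) / (2 * real n powr (1 / 2))) *\<^sub>R \<mu>)\<bar>)) sequentially"
    proof (intro always_eventually allI)
      fix n
      \<comment> \<open>a supremum over the empty set would be \<open>- \<infinity>\<close>, so a lattice point has to be exhibited\<close>
      have "(real n powr (- 3 / 2)) *\<^sub>R ((1 / 2 * real n * (real n + 1)) *\<^sub>R b + H *v 0) \<in> scaled_lattice H b n"
        unfolding scaled_lattice_def by (intro imageI int_points_0)
      then show "0 \<le> (SUP x \<in> scaled_lattice H b n.
            ereal \<bar>real n powr (3 * real CARD('d) / 2) / h * com_pmf P X n x
                   - gauss_density M (x - ((real n + 1) / (2 * real n powr (1 / 2))) *\<^sub>R \<mu>)\<bar>)"
        by (rule SUP_upper2) simp
    qed
    show "eventually (\<lambda>n. (SUP x \<in> scaled_lattice H b n.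
            ereal \<bar>real n powr (3 * real CARD('d) / 2) / h * com_pmf P X n x
                   - gauss_density M (x - ((real n + 1) / (2 * real n powr (1 / 2))) *\<^sub>R \<mu>)\<bar>) \<le> ereal (fourier_error n / h)) sequentially"
      using eventually_gt_at_top[of 0]
    proof eventually_elim
      case (elim n)
      show ?case by (intro SUP_least) (simp only: ereal_less_eq bound[OF elim])
    qed
    have "(\<lambda>n. fourier_error n / h) \<longlonglongrightarrow> 0 / h" by (rule tendsto_divide[OF fourier_error_tendsto_0 tendsto_const]) (use assms(9) in auto)
    then show "(\<lambda>n. ereal (fourier_error n / h)) \<longlonglongrightarrow> 0"
      using tendsto_ereal[of "\<lambda>n. fourier_error n / h" 0] by (simp add: zero_ereal_def)
  qed simp
qed

end
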